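(* Let $p$ be an odd prime, and for each integer $n\ge1$ let $N_n=p^n-1$ and $$U_n(z)={}_2F_1\!\left(-\tfrac{N_n}2,\tfrac{N_n}2+1;-N_n;z\right)\cdot {}_2F_1\!\left(-\tfrac{N_n}2,\tfrac{N_n}2+1;-N_n;\tfrac{z}{z-1}\right)(1-z)^{N_n/2},$$ which is the generating function $\sum_{k=0}^{N_n}v_kz^{N_n-k}$ of the eigenvector $\vec v=(v_k)_{k=0}^{N_n}$, normalized by $v_{N_n}=1$, with eigenvalue $1$ of the $(N_n+1)\times(N_n+1)$ symmetric Pascal matrix $T_{N_n}$. Let $$F(z)={}_2F_1\!\left(\tfrac12,\tfrac12;1;z\right)=\sum_{k=0}^\infty\binom{2k}{k}^2\frac{z^k}{16^k}.$$ Then for all $z\in\mathbb{Q}_p$ with $|z|_p<1$, $$U_n(z)\equiv F(z)^2 \mod p^n\quad\text{for every } n\ge 1,$$ and consequently $U_n(z)\to F(z)^2$ $p$-adically as $n\to\infty$.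
   Context: The symmetric Pascal matrix $T_N$ has entries $(T_N)_{j,k}=\binom{j+k}{j}$, $0\le j,k\le N$. For $N$ even, ${}_2F_1(-N/2,N/2+1;-N;x)=\sum_{k=0}^{N/2}\frac{(-N/2)_k(N/2+1)_k}{(-N)_k\,k!}x^k$, with $(q)_k=q(q+1)\cdots(q+k-1)$. The series $F(z)$ converges $p$-adically for $|z|_p<1$. A congruence $a\equiv b\mod p^n$ for $a,b\in\mathbb{Q}_p$ means $a-b\in p^n\mathbb{Z}_p$. *)

theory Defs
  imports
    "HOL-Computational_Algebra.Squarefree"
    "Berlekamp_Zassenhaus.Finite_Field"
    "Jordan_Normal_Form.Char_Poly"
begin

section \<open>The $p$-adic absolute value on the rationals\<close>

definition padic_abs :: "nat \<Rightarrow> rat \<Rightarrow> real" where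
  "padic_abs p q = (if q = 0 then 0 else
     real p powi (int (multiplicity (int p) (snd (quotient_of q)))
                - int (multiplicity (int p) (fst (quotient_of q)))))"

definition padic_cauchy :: "nat \<Rightarrow> (nat \<Rightarrow> rat) \<Rightarrow> bool" where
  "padic_cauchy p X \<longleftrightarrow> (\<forall>e>0. \<exists>k. \<forall>m\<ge>k. \<forall>n\<ge>k. padic_abs p (X m - X n) < e)"

definition padic_null :: "nat \<Rightarrow> (nat \<Rightarrow> rat) \<Rightarrow> bool" where
  "padic_null p X \<longleftrightarrow> (\<forall>e>0. \<exists>k. \<forall>n\<ge>k. padic_abs p (X n) < e)"

definition padic_rel :: "nat \<Rightarrow> (nat \<Rightarrow> rat) \<Rightarrow> (nat \<Rightarrow> rat) \<Rightarrow> bool" where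
  "padic_rel p X Y \<longleftrightarrow> padic_cauchy p X \<and> padic_cauchy p Y \<and> padic_null p (\<lambda>n. X n - Y n)"

lemma rat_as_quotient: obtains a b where "(x :: rat) = of_int a / of_int b" "b > 0"
proof -
  obtain a b where ab: "quotient_of x = (a, b)" by fastforce
  show ?thesis using that[OF quotient_of_div[OF ab] quotient_of_denom_pos[OF ab]] .
qed

context
  fixes p :: nat
  assumes p: "prime p"
begin

lemma padic_abs_0 [simp]: "padic_abs p 0 = 0"
  by (simp add: padic_abs_def)

lemma padic_abs_nonneg [simp]: "0 \<le> padic_abs p x"
  by (simp add: padic_abs_def)

lemma padic_abs_eq_0_iff [simp]: "padic_abs p x = 0 \<longleftrightarrow> x = 0"
  using prime_gt_0_nat[OF p] by (simp add: padic_abs_def)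

lemma padic_abs_of_int_divide:
  assumes "a \<noteq> 0" "b \<noteq> 0"
  shows "padic_abs p (of_int a / of_int b)
         = real p powi (int (multiplicity (int p) b) - int (multiplicity (int p) a))"
proof -
  let ?q = "of_int a / of_int b :: rat"
  obtain c d where cd: "quotient_of ?q = (c, d)" by fastforce
  have d: "d > 0" using quotient_of_denom_pos[OF cd] .
  have q: "?q = of_int c / of_int d" by (rule quotient_of_div[OF cd])
  have "of_int (a * d) = (of_int (c * b) :: rat)"
    using q assms d by (simp add: field_simps)
  hence e: "a * d = c * b" by (simp only: of_int_eq_iff)
  have c: "c \<noteq> 0" using e assms d by auto
  have pp: "prime_elem (int p)" using p by simp
  have "multiplicity (int p) a + multiplicity (int p) d
      = multiplicity (int p) c + multiplicity (int p) b"
    using arg_cong[OF e, of "multiplicity (int p)"] assms c d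
    by (simp add: prime_elem_multiplicity_mult_distrib[OF pp])
  hence "int (multiplicity (int p) d) - int (multiplicity (int p) c)
       = int (multiplicity (int p) b) - int (multiplicity (int p) a)" by linarith
  thus ?thesis using assms by (simp add: padic_abs_def cd)
qed

lemma padic_abs_1 [simp]: "padic_abs p 1 = 1"
  using padic_abs_of_int_divide[of 1 1] by simp

lemma padic_abs_mult: "padic_abs p (x * y) = padic_abs p x * padic_abs p y"
proof (cases "x = 0 \<or> y = 0")
  case False
  obtain a b where x: "x = of_int a / of_int b" "b > 0" by (rule rat_as_quotient)
  obtain c d where y: "y = of_int c / of_int d" "d > 0" by (rule rat_as_quotient)
  have nz: "a \<noteq> 0" "b \<noteq> 0" "c \<noteq> 0" "d \<noteq> 0" using x y False by auto
  have pp: "prime_elem (int p)" using p by simp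
  have p0: "real p \<noteq> 0" using prime_gt_0_nat[OF p] by simp
  have xy: "x * y = of_int (a * c) / of_int (b * d)" using x y by simp
  let ?m = "\<lambda>k. int (multiplicity (int p) k)"
  have "padic_abs p (x * y) = real p powi (?m (b * d) - ?m (a * c))"
    unfolding xy by (rule padic_abs_of_int_divide) (use nz in auto)
  also have "?m (b * d) - ?m (a * c) = (?m b - ?m a) + (?m d - ?m c)"
    using nz by (simp add: prime_elem_multiplicity_mult_distrib[OF pp])
  also have "real p powi \<dots> = real p powi (?m b - ?m a) * real p powi (?m d - ?m c)"
    by (rule power_int_add) (use p0 in simp)
  also have "\<dots> = padic_abs p x * padic_abs p y"
    unfolding x(1) y(1)
    by (simp only: padic_abs_of_int_divide[OF nz(1,2)] padic_abs_of_int_divide[OF nz(3,4)])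
  finally show ?thesis .
qed auto

lemma padic_abs_minus [simp]: "padic_abs p (- x) = padic_abs p x"
proof (cases "x = 0")
  case False
  obtain a b where x: "x = of_int a / of_int b" "b > 0" by (rule rat_as_quotient)
  have a: "a \<noteq> 0" using x False by auto
  have mx: "- x = of_int (- a) / of_int b" using x by simp
  have "padic_abs p (- x) = padic_abs p x"
    unfolding mx unfolding x(1) using a x(2)
    by (subst (1 2) padic_abs_of_int_divide) simp_all
  thus ?thesis .
qed auto

lemma padic_abs_minus_commute: "padic_abs p (x - y) = padic_abs p (y - x)"
  using padic_abs_minus[of "y - x"] unfolding minus_diff_eq .

lemma padic_abs_inverse: "padic_abs p (inverse x) = inverse (padic_abs p x)"
proof (cases "x = 0")
  case False
  hence "padic_abs p x * padic_abs p (inverse x) = 1"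
    by (simp flip: padic_abs_mult)
  thus ?thesis by (rule inverse_unique[symmetric])
qed auto

lemma padic_abs_int_le_1: "padic_abs p (of_int a) \<le> 1"
proof (cases "a = 0")
  case False
  have p1: "1 \<le> real p" using prime_ge_1_nat[OF p] by simp
  have "padic_abs p (of_int a) = real p powi (- int (multiplicity (int p) a))"
    using padic_abs_of_int_divide[of a 1] False by simp
  also have "\<dots> = inverse (real p ^ multiplicity (int p) a)"
    by (simp add: power_int_minus)
  also have "\<dots> \<le> 1" using p1 by (simp add: inverse_le_1_iff)
  finally show ?thesis .
qed auto

lemma padic_abs_le_1_imp: 
  assumes "padic_abs p x \<le> 1"
  shows "padic_abs p (1 + x) \<le> 1"
proof (cases "x = 0")
  case False
  obtain a b where ab: "quotient_of x = (a, b)" by (cases "quotient_of x")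
  have b: "b > 0" using quotient_of_denom_pos[OF ab] .
  have x: "x = of_int a / of_int b" by (rule quotient_of_div[OF ab])
  have a: "a \<noteq> 0" using x False by auto
  have p1: "1 < real p" using prime_gt_1_nat[OF p] by simp
  have "\<not> int p dvd b"
  proof
    assume db: "int p dvd b"
    have cop: "coprime a b" using quotient_of_coprime[OF ab] .
    have pp: "prime (int p)" using p by simp
    have "\<not> int p dvd a"
    proof
      assume "int p dvd a"
      hence "is_unit (int p)" using coprime_common_divisor[OF cop _ db] by simp
      thus False using not_prime_unit pp by blast
    qed
    hence ma: "multiplicity (int p) a = 0" by (rule not_dvd_imp_multiplicity_0)
    have mb: "multiplicity (int p) b > 0"
      using db b pp by (simp add: prime_multiplicity_gt_zero_iff)
    have "padic_abs p x = real p ^ multiplicity (int p) b"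
      using a b ma by (simp add: x padic_abs_of_int_divide)
    also have "\<dots> > 1" using p1 mb by (simp add: one_less_power)
    finally show False using assms by simp
  qed
  hence mb: "multiplicity (int p) b = 0" by (rule not_dvd_imp_multiplicity_0)
  have b1: "padic_abs p (of_int b) = 1"
    using padic_abs_of_int_divide[of b 1] b mb by simp
  have "1 + x = of_int (a + b) * inverse (of_int b)" using b by (simp add: x field_simps)
  hence "padic_abs p (1 + x) = padic_abs p (of_int (a + b))"
    by (simp only: padic_abs_mult padic_abs_inverse b1) simp
  thus ?thesis using padic_abs_int_le_1[of "a + b"] by linarith
next
  case True
  show ?thesis by (simp add: True)
qed

lemma padic_abs_add_le: "padic_abs p (x + y) \<le> max (padic_abs p x) (padic_abs p y)"
proof -
  have *: "padic_abs p (x + y) \<le> padic_abs p x"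
    if le: "padic_abs p y \<le> padic_abs p x" for x y
  proof (cases "x = 0")
    case True
    thus ?thesis using le by simp
  next
    case False
    have x: "padic_abs p x > 0" using False by (simp add: less_le)
    have "padic_abs p (y / x) = padic_abs p y / padic_abs p x"
      by (simp only: divide_inverse padic_abs_mult padic_abs_inverse)
    hence "padic_abs p (y / x) \<le> 1" using x le by simp
    hence l: "padic_abs p (1 + y / x) \<le> 1" by (rule padic_abs_le_1_imp)
    have "x + y = x * (1 + y / x)" using False by (simp add: field_simps)
    hence "padic_abs p (x + y) = padic_abs p x * padic_abs p (1 + y / x)"
      by (simp only: padic_abs_mult)
    also have "\<dots> \<le> padic_abs p x" using l by (simp add: mult_left_le)
    finally show ?thesis .
  qed
  show ?thesis
  proof (cases "padic_abs p y \<le> padic_abs p x")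
    case True
    show ?thesis using *[OF True] by (rule max.coboundedI1)
  next
    case False
    hence "padic_abs p (y + x) \<le> padic_abs p y" by (intro *) simp
    thus ?thesis unfolding add.commute[of y x] by (rule max.coboundedI2)
  qed
qed

lemma padic_abs_diff_le: "padic_abs p (x - y) \<le> max (padic_abs p x) (padic_abs p y)"
  using padic_abs_add_le[of x "- y"] by simp

lemma padic_abs_add_less:
  "padic_abs p x < e \<Longrightarrow> padic_abs p y < e \<Longrightarrow> padic_abs p (x + y) < e"
  using padic_abs_add_le[of x y] by linarith

lemma padic_abs_reverse_triangle:
  "\<bar>padic_abs p x - padic_abs p y\<bar> \<le> padic_abs p (x - y)"
proof -
  have "padic_abs p x \<le> padic_abs p (x - y) + padic_abs p y"
    using padic_abs_add_le[of "x - y" y, unfolded diff_add_cancel]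
      padic_abs_nonneg[of "x - y"] padic_abs_nonneg[of y] by linarith
  moreover have "padic_abs p y \<le> padic_abs p (x - y) + padic_abs p x"
    using padic_abs_add_le[of "y - x" x, unfolded diff_add_cancel]
      padic_abs_nonneg[of "x - y"] padic_abs_nonneg[of x] padic_abs_minus_commute[of y x]
    by linarith
  ultimately show ?thesis by linarith
qed

lemma padic_cauchyD:
  "padic_cauchy p X \<Longrightarrow> 0 < e \<Longrightarrow> \<exists>k. \<forall>m\<ge>k. \<forall>n\<ge>k. padic_abs p (X m - X n) < e"
  by (simp add: padic_cauchy_def)

lemma padic_cauchy_const [simp]: "padic_cauchy p (\<lambda>n. c)"
  by (simp add: padic_cauchy_def)

lemma padic_null_iff: "padic_null p X \<longleftrightarrow> (\<lambda>n. padic_abs p (X n)) \<longlonglongrightarrow> 0"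
  by (simp add: padic_null_def LIMSEQ_iff)

lemma padic_null_const [simp]: "padic_null p (\<lambda>n. c) \<longleftrightarrow> c = 0"
  by (simp add: padic_null_iff LIMSEQ_const_iff)

lemma padic_null_minus: "padic_null p X \<Longrightarrow> padic_null p (\<lambda>n. - X n)"
  by (simp add: padic_null_def)

lemma padic_null_add:
  assumes "padic_null p X" "padic_null p Y"
  shows "padic_null p (\<lambda>n. X n + Y n)"
  unfolding padic_null_def
proof (intro allI impI)
  fix e :: real assume e: "e > 0"
  obtain i where i: "\<forall>n\<ge>i. padic_abs p (X n) < e" using assms(1) e by (auto simp: padic_null_def)
  obtain j where j: "\<forall>n\<ge>j. padic_abs p (Y n) < e" using assms(2) e by (auto simp: padic_null_def)
  show "\<exists>k. \<forall>n\<ge>k. padic_abs p (X n + Y n) < e"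
    by (rule exI[of _ "max i j"]) (use i j in \<open>auto intro: padic_abs_add_less\<close>)
qed

lemma padic_cauchy_add:
  assumes "padic_cauchy p X" "padic_cauchy p Y"
  shows "padic_cauchy p (\<lambda>n. X n + Y n)"
  unfolding padic_cauchy_def
proof (intro allI impI)
  fix e :: real assume e: "e > 0"
  obtain i where i: "\<forall>m\<ge>i. \<forall>n\<ge>i. padic_abs p (X m - X n) < e"
    using padic_cauchyD[OF assms(1) e] ..
  obtain j where j: "\<forall>m\<ge>j. \<forall>n\<ge>j. padic_abs p (Y m - Y n) < e"
    using padic_cauchyD[OF assms(2) e] ..
  have eq: "(X m + Y m) - (X n + Y n) = (X m - X n) + (Y m - Y n)" for m n by simp
  show "\<exists>k. \<forall>m\<ge>k. \<forall>n\<ge>k. padic_abs p ((X m + Y m) - (X n + Y n)) < e"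
    unfolding eq
    by (rule exI[of _ "max i j"]) (use i j in \<open>auto intro!: padic_abs_add_less\<close>)
qed

lemma padic_cauchy_minus:
  assumes "padic_cauchy p X"
  shows "padic_cauchy p (\<lambda>n. - X n)"
proof -
  have "- X m - - X n = - (X m - X n)" for m n by simp
  thus ?thesis using assms unfolding padic_cauchy_def by (simp only: padic_abs_minus)
qed

lemma padic_cauchy_imp_bounded:
  assumes "padic_cauchy p X"
  obtains b where "b > 0" "\<And>n. padic_abs p (X n) \<le> b"
proof -
  obtain k where k: "\<forall>m\<ge>k. \<forall>n\<ge>k. padic_abs p (X m - X n) < 1"
    using padic_cauchyD[OF assms, of 1] by auto
  define M where "M = Max ((\<lambda>n. padic_abs p (X n)) ` {..k})"
  have M: "padic_abs p (X n) \<le> M" if "n \<le> k" for n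
    unfolding M_def using that by (intro Max_ge) auto
  have "padic_abs p (X n) \<le> max M 1" for n
  proof (cases "n \<le> k")
    case True
    thus ?thesis using M[of n] by simp
  next
    case False
    hence "padic_abs p (X n - X k) < 1" using k by auto
    thus ?thesis
      using padic_abs_add_le[of "X n - X k" "X k", unfolded diff_add_cancel] M[of k] by linarith
  qed
  thus ?thesis by (intro that[of "max M 1"]) auto
qed

lemma padic_null_mult_bounded:
  assumes b: "b > 0" "\<And>n. padic_abs p (X n) \<le> b" and Y: "padic_null p Y"
  shows "padic_null p (\<lambda>n. X n * Y n)"
  unfolding padic_null_def
proof (intro allI impI)
  fix e :: real assume e: "e > 0"
  obtain k where k: "\<forall>n\<ge>k. padic_abs p (Y n) < e / b"
    using Y e b by (metis padic_null_def divide_pos_pos)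
  have "padic_abs p (X n * Y n) < e" if "n \<ge> k" for n
  proof -
    have "padic_abs p (X n * Y n) \<le> b * padic_abs p (Y n)"
      by (simp add: padic_abs_mult mult_right_mono b)
    also have "\<dots> < b * (e / b)" using k that b by (intro mult_strict_left_mono) auto
    finally show ?thesis using b by simp
  qed
  thus "\<exists>k. \<forall>n\<ge>k. padic_abs p (X n * Y n) < e" by blast
qed

lemma padic_cauchy_mult:
  assumes "padic_cauchy p X" "padic_cauchy p Y"
  shows "padic_cauchy p (\<lambda>n. X n * Y n)"
  unfolding padic_cauchy_def
proof (intro allI impI)
  fix e :: real assume e: "e > 0"
  obtain a where a: "a > 0" "\<And>n. padic_abs p (X n) \<le> a"
    using padic_cauchy_imp_bounded[OF assms(1)] by blast
  obtain b where b: "b > 0" "\<And>n. padic_abs p (Y n) \<le> b"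
    using padic_cauchy_imp_bounded[OF assms(2)] by blast
  obtain i where i: "\<forall>m\<ge>i. \<forall>n\<ge>i. padic_abs p (X m - X n) < e / b"
    using padic_cauchyD[OF assms(1)] e b by (meson divide_pos_pos)
  obtain j where j: "\<forall>m\<ge>j. \<forall>n\<ge>j. padic_abs p (Y m - Y n) < e / a"
    using padic_cauchyD[OF assms(2)] e a by (meson divide_pos_pos)
  have "padic_abs p (X m * Y m - X n * Y n) < e"
    if mn: "m \<ge> max i j" "n \<ge> max i j" for m n
  proof -
    have "padic_abs p (X m * (Y m - Y n)) \<le> a * padic_abs p (Y m - Y n)"
      by (simp add: padic_abs_mult mult_right_mono a)
    also have "\<dots> < a * (e / a)" using j mn a by (intro mult_strict_left_mono) auto
    finally have 1: "padic_abs p (X m * (Y m - Y n)) < e" using a by simp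
    have "padic_abs p ((X m - X n) * Y n) \<le> padic_abs p (X m - X n) * b"
      by (simp add: padic_abs_mult mult_left_mono b)
    also have "\<dots> < (e / b) * b" using i mn b by (intro mult_strict_right_mono) auto
    finally have 2: "padic_abs p ((X m - X n) * Y n) < e" using b by simp
    have "X m * Y m - X n * Y n = X m * (Y m - Y n) + (X m - X n) * Y n"
      by (simp add: algebra_simps)
    thus ?thesis using padic_abs_add_less[OF 1 2] by simp
  qed
  thus "\<exists>k. \<forall>m\<ge>k. \<forall>n\<ge>k. padic_abs p (X m * Y m - X n * Y n) < e" by blast
qed

lemma padic_cauchy_not_null:
  assumes X: "padic_cauchy p X" and nz: "\<not> padic_null p X"
  obtains b k where "b > 0" "\<And>n. n \<ge> k \<Longrightarrow> b \<le> padic_abs p (X n)"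
proof -
  obtain b where b: "b > 0" and r: "\<forall>k. \<exists>n\<ge>k. b \<le> padic_abs p (X n)"
    using nz unfolding padic_null_def by (auto simp: not_less)
  obtain k where k: "\<forall>m\<ge>k. \<forall>n\<ge>k. padic_abs p (X m - X n) < b"
    using padic_cauchyD[OF X b] ..
  obtain l where l: "l \<ge> k" "b \<le> padic_abs p (X l)" using r by blast
  have "b \<le> padic_abs p (X n)" if "n \<ge> k" for n
  proof (rule ccontr)
    assume "\<not> b \<le> padic_abs p (X n)"
    moreover have "padic_abs p (X l - X n) < b" using k l that by blast
    ultimately have "padic_abs p (X l) < b"
      using padic_abs_add_less[of "X l - X n" b "X n"] by simp
    thus False using l by simp
  qed
  thus ?thesis using b that by blast
qed

lemma padic_abs_inverse_diff:
  assumes "x \<noteq> 0" "y \<noteq> 0"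
  shows "padic_abs p (inverse x - inverse y)
         = padic_abs p (x - y) / (padic_abs p x * padic_abs p y)"
proof -
  have "inverse x - inverse y = - ((x - y) * inverse x * inverse y)"
    using assms by (simp add: field_simps)
  thus ?thesis
    by (simp only: padic_abs_minus padic_abs_mult padic_abs_inverse)
       (simp add: divide_inverse mult.assoc)
qed

lemma padic_abs_inverse_diff_less:
  assumes "b > 0" "c > 0" "b \<le> padic_abs p x" "c \<le> padic_abs p y"
    "padic_abs p (x - y) < e * (b * c)"
  shows "padic_abs p (inverse x - inverse y) < e"
proof -
  have nz: "x \<noteq> 0" "y \<noteq> 0" using assms by auto
  have "padic_abs p (x - y) / (padic_abs p x * padic_abs p y) \<le> padic_abs p (x - y) / (b * c)"
    using assms by (intro divide_left_mono mult_mono mult_pos_pos) auto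
  also have "\<dots> < e" using assms by (simp add: field_simps)
  finally show ?thesis by (simp add: padic_abs_inverse_diff[OF nz])
qed

lemma padic_cauchy_inverse:
  assumes X: "padic_cauchy p X" and nz: "\<not> padic_null p X"
  shows "padic_cauchy p (\<lambda>n. inverse (X n))"
  unfolding padic_cauchy_def
proof (intro allI impI)
  fix e :: real assume e: "e > 0"
  obtain b k where b: "b > 0" "\<And>n. n \<ge> k \<Longrightarrow> b \<le> padic_abs p (X n)"
    using padic_cauchy_not_null[OF X nz] by metis
  obtain i where i: "\<forall>m\<ge>i. \<forall>n\<ge>i. padic_abs p (X m - X n) < e * (b * b)"
    using padic_cauchyD[OF X, of "e * (b * b)"] e b by auto
  show "\<exists>k. \<forall>m\<ge>k. \<forall>n\<ge>k. padic_abs p (inverse (X m) - inverse (X n)) < e"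
    by (rule exI[of _ "max i k"])
       (use i b in \<open>auto intro!: padic_abs_inverse_diff_less[of b b]\<close>)
qed

lemma padic_null_diff_inverse:
  assumes X: "padic_cauchy p X" "\<not> padic_null p X"
    and Y: "padic_cauchy p Y" "\<not> padic_null p Y"
    and XY: "padic_null p (\<lambda>n. X n - Y n)"
  shows "padic_null p (\<lambda>n. inverse (X n) - inverse (Y n))"
  unfolding padic_null_def
proof (intro allI impI)
  fix e :: real assume e: "e > 0"
  obtain b k where b: "b > 0" "\<And>n. n \<ge> k \<Longrightarrow> b \<le> padic_abs p (X n)"
    using padic_cauchy_not_null[OF X] by metis
  obtain c l where c: "c > 0" "\<And>n. n \<ge> l \<Longrightarrow> c \<le> padic_abs p (Y n)"
    using padic_cauchy_not_null[OF Y] by metis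
  have "e * (b * c) > 0" using e b c by simp
  then obtain i where i: "\<forall>n\<ge>i. padic_abs p (X n - Y n) < e * (b * c)"
    using XY unfolding padic_null_def by blast
  show "\<exists>k. \<forall>n\<ge>k. padic_abs p (inverse (X n) - inverse (Y n)) < e"
    by (rule exI[of _ "max i (max k l)"])
       (use i b c in \<open>auto intro!: padic_abs_inverse_diff_less[of b c]\<close>)
qed

lemma padic_null_cong:
  assumes "padic_null p X" "padic_null p (\<lambda>n. X n - Y n)"
  shows "padic_null p Y"
  using padic_null_add[OF assms(1) padic_null_minus[OF assms(2)]] by simp

lemma padic_rel_refl: "padic_cauchy p X \<Longrightarrow> padic_rel p X X"
  by (simp add: padic_rel_def)

lemma padic_rel_sym: "padic_rel p X Y \<Longrightarrow> padic_rel p Y X"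
  by (simp add: padic_rel_def padic_null_def padic_abs_minus_commute)

lemma padic_rel_trans: "padic_rel p X Y \<Longrightarrow> padic_rel p Y Z \<Longrightarrow> padic_rel p X Z"
  using padic_null_add[of "\<lambda>n. X n - Y n" "\<lambda>n. Y n - Z n"] by (simp add: padic_rel_def)

lemma padic_rel_add:
  assumes "padic_rel p X X'" "padic_rel p Y Y'"
  shows "padic_rel p (\<lambda>n. X n + Y n) (\<lambda>n. X' n + Y' n)"
  using assms unfolding padic_rel_def add_diff_add
  by (simp add: padic_cauchy_add padic_null_add)

lemma padic_rel_minus:
  assumes "padic_rel p X Y"
  shows "padic_rel p (\<lambda>n. - X n) (\<lambda>n. - Y n)"
  using assms unfolding padic_rel_def minus_diff_minus
  by (simp add: padic_cauchy_minus padic_null_minus del: minus_diff_eq)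

lemma padic_rel_mult:
  assumes XX: "padic_rel p X X'" and YY: "padic_rel p Y Y'"
  shows "padic_rel p (\<lambda>n. X n * Y n) (\<lambda>n. X' n * Y' n)"
proof -
  obtain a where a: "a > 0" "\<And>n. padic_abs p (X n) \<le> a"
    using padic_cauchy_imp_bounded[of X] XX by (auto simp: padic_rel_def)
  obtain b where b: "b > 0" "\<And>n. padic_abs p (Y' n) \<le> b"
    using padic_cauchy_imp_bounded[of Y'] YY by (auto simp: padic_rel_def)
  have "padic_null p (\<lambda>n. X n * (Y n - Y' n) + Y' n * (X n - X' n))"
    using a b XX YY
    by (intro padic_null_add padic_null_mult_bounded[of a] padic_null_mult_bounded[of b])
       (auto simp: padic_rel_def)
  moreover have "X n * (Y n - Y' n) + Y' n * (X n - X' n) = X n * Y n - X' n * Y' n" for n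
    by (simp add: algebra_simps)
  ultimately show ?thesis
    using XX YY by (simp add: padic_rel_def padic_cauchy_mult)
qed

lemma padic_rel_inverse:
  assumes "padic_rel p X Y" "\<not> padic_null p X"
  shows "padic_rel p (\<lambda>n. inverse (X n)) (\<lambda>n. inverse (Y n))"
proof -
  have YX: "padic_null p (\<lambda>n. Y n - X n)"
    using padic_rel_sym[OF assms(1)] by (simp add: padic_rel_def)
  have "\<not> padic_null p Y" using padic_null_cong[OF _ YX] assms(2) by blast
  thus ?thesis
    using assms by (simp add: padic_rel_def padic_cauchy_inverse padic_null_diff_inverse)
qed

lemma padic_cauchy_abs:
  assumes "padic_cauchy p X"
  shows "Cauchy (\<lambda>n. padic_abs p (X n))"
  unfolding Cauchy_def dist_real_def
  using assms padic_abs_reverse_triangle order.strict_trans1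
  unfolding padic_cauchy_def by meson

lemma padic_rel_lim:
  assumes "padic_rel p X Y"
  shows "lim (\<lambda>n. padic_abs p (X n)) = lim (\<lambda>n. padic_abs p (Y n))"
proof -
  have Y: "(\<lambda>n. padic_abs p (Y n)) \<longlonglongrightarrow> lim (\<lambda>n. padic_abs p (Y n))"
    using padic_cauchy_abs[of Y] assms
    by (simp add: padic_rel_def Cauchy_convergent_iff convergent_LIMSEQ_iff)
  have "(\<lambda>n. padic_abs p (X n - Y n)) \<longlonglongrightarrow> 0"
    using assms by (simp add: padic_rel_def padic_null_iff)
  hence "(\<lambda>n. padic_abs p (X n) - padic_abs p (Y n)) \<longlonglongrightarrow> 0"
    by (rule tendsto_0_le[where K = 1]) (simp add: padic_abs_reverse_triangle)
  from tendsto_add[OF this Y] show ?thesis by (simp add: limI)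
qed

end


section \<open>The field of $p$-adic numbers\<close>

text \<open>
  The completion of the rationals for the $p$-adic absolute value: Cauchy sequences modulo null
  sequences. The prime is carried by the type: in \<open>'p padic\<close> it is the cardinality of \<open>'p\<close>.
\<close>

typedef (overloaded) 'p padic =
  "{c. \<exists>X. padic_cauchy CARD('p::prime_card) X \<and> c = {Y. padic_rel CARD('p) X Y}}"
  using padic_cauchy_const[OF prime_card] by blast

definition Padic :: "(nat \<Rightarrow> rat) \<Rightarrow> 'p::prime_card padic" where
  "Padic X = Abs_padic {Y. padic_rel CARD('p) X Y}"

definition padic_seq :: "'p::prime_card padic \<Rightarrow> nat \<Rightarrow> rat" where
  "padic_seq x = (SOME X. padic_cauchy CARD('p) X \<and> Padic X = x)"

lemma Padic_eqI: "padic_rel CARD('p) X Y \<Longrightarrow> (Padic X :: 'p::prime_card padic) = Padic Y"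
proof -
  assume XY: "padic_rel CARD('p) X Y"
  have "{Z. padic_rel CARD('p) X Z} = {Z. padic_rel CARD('p) Y Z}"
    using padic_rel_trans[OF prime_card XY]
      padic_rel_trans[OF prime_card padic_rel_sym[OF prime_card XY]] by blast
  thus ?thesis by (simp add: Padic_def)
qed

lemma eq_Padic:
  assumes "padic_cauchy CARD('p) X" "padic_cauchy CARD('p) Y"
  shows "(Padic X :: 'p::prime_card padic) = Padic Y \<longleftrightarrow> padic_null CARD('p) (\<lambda>n. X n - Y n)"
proof
  assume "(Padic X :: 'p padic) = Padic Y"
  moreover have "{Z. padic_rel CARD('p) X Z} \<in>
      {c. \<exists>X. padic_cauchy CARD('p) X \<and> c = {Y. padic_rel CARD('p) X Y}}"
    "{Z. padic_rel CARD('p) Y Z} \<in>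
      {c. \<exists>X. padic_cauchy CARD('p) X \<and> c = {Y. padic_rel CARD('p) X Y}}"
    using assms by blast+
  ultimately have "{Z. padic_rel CARD('p) X Z} = {Z. padic_rel CARD('p) Y Z}"
    unfolding Padic_def by (simp only: Abs_padic_inject)
  hence "padic_rel CARD('p) X Y"
    using padic_rel_refl[OF prime_card assms(2)] by blast
  thus "padic_null CARD('p) (\<lambda>n. X n - Y n)" by (simp add: padic_rel_def)
next
  assume "padic_null CARD('p) (\<lambda>n. X n - Y n)"
  thus "(Padic X :: 'p padic) = Padic Y"
    using assms by (intro Padic_eqI) (simp add: padic_rel_def)
qed

lemma Padic_induct [case_names Padic, induct type: padic]:
  assumes "\<And>X. padic_cauchy CARD('p) X \<Longrightarrow> P (Padic X)"
  shows "P (x :: 'p::prime_card padic)"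
  using assms by (cases x rule: Abs_padic_cases) (auto simp: Padic_def)

lemma padic_seq: "padic_cauchy CARD('p) (padic_seq x)" "Padic (padic_seq x) = (x :: 'p::prime_card padic)"
proof -
  have "\<exists>X. padic_cauchy CARD('p) X \<and> Padic X = x" by (induct x) blast
  hence "padic_cauchy CARD('p) (padic_seq x) \<and> Padic (padic_seq x) = x"
    unfolding padic_seq_def by (rule someI_ex)
  thus "padic_cauchy CARD('p) (padic_seq x)" "Padic (padic_seq x) = x" by auto
qed

lemma padic_seq_Padic:
  assumes "padic_cauchy CARD('p) X"
  shows "padic_rel CARD('p) (padic_seq (Padic X :: 'p::prime_card padic)) X"
  using assms padic_seq(1)[of "Padic X :: 'p padic"] eq_Padic[of "padic_seq (Padic X :: 'p padic)" X, where ?'p = 'p]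
  by (simp add: padic_rel_def padic_seq(2))

instantiation padic :: (prime_card) "{zero, one, plus, uminus, minus, times, inverse}"
begin

definition zero_padic :: "'a padic" where "0 = Padic (\<lambda>n. 0)"

definition one_padic :: "'a padic" where "1 = Padic (\<lambda>n. 1)"

definition plus_padic :: "'a padic \<Rightarrow> 'a padic \<Rightarrow> 'a padic" where
  "x + y = Padic (\<lambda>n. padic_seq x n + padic_seq y n)"

definition uminus_padic :: "'a padic \<Rightarrow> 'a padic" where
  "- x = Padic (\<lambda>n. - padic_seq x n)"

definition "x - y = x + - y" for x y :: "'a padic"

definition times_padic :: "'a padic \<Rightarrow> 'a padic \<Rightarrow> 'a padic" where
  "x * y = Padic (\<lambda>n. padic_seq x n * padic_seq y n)"

definition inverse_padic :: "'a padic \<Rightarrow> 'a padic" where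
  "inverse x = (if x = 0 then 0 else Padic (\<lambda>n. inverse (padic_seq x n)))"

definition "x div y = x * inverse y" for x y :: "'a padic"

instance ..

end

text \<open>
  The library constant \<^const>\<open>norm\<close> is reserved for real normed vector spaces, so the absolute
  value has its own name.
\<close>

definition padic_norm :: "'p::prime_card padic \<Rightarrow> real" where
  "padic_norm x = lim (\<lambda>n. padic_abs CARD('p) (padic_seq x n))"

context
  fixes X Y :: "nat \<Rightarrow> rat"
  assumes X: "padic_cauchy CARD('p::prime_card) X" and Y: "padic_cauchy CARD('p) Y"
begin

lemma plus_Padic: "(Padic X + Padic Y :: 'p padic) = Padic (\<lambda>n. X n + Y n)"
  unfolding plus_padic_def
  by (intro Padic_eqI padic_rel_add padic_seq_Padic prime_card X Y)

lemma times_Padic: "(Padic X * Padic Y :: 'p padic) = Padic (\<lambda>n. X n * Y n)"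
  unfolding times_padic_def
  by (intro Padic_eqI padic_rel_mult padic_seq_Padic prime_card X Y)

end

context
  fixes X :: "nat \<Rightarrow> rat"
  assumes X: "padic_cauchy CARD('p::prime_card) X"
begin

lemma uminus_Padic: "- (Padic X :: 'p padic) = Padic (\<lambda>n. - X n)"
  unfolding uminus_padic_def
  by (intro Padic_eqI padic_rel_minus padic_seq_Padic prime_card X)

lemma Padic_eq_0_iff: "(Padic X :: 'p padic) = 0 \<longleftrightarrow> padic_null CARD('p) X"
  using eq_Padic[OF X, of "\<lambda>n. 0"]
  by (simp add: zero_padic_def prime_card)

lemma inverse_Padic:
  assumes "\<not> padic_null CARD('p) X"
  shows "inverse (Padic X :: 'p padic) = Padic (\<lambda>n. inverse (X n))"
proof -
  have "padic_rel CARD('p) (\<lambda>n. inverse (X n)) (\<lambda>n. inverse (padic_seq (Padic X :: 'p padic) n))"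
    using padic_rel_inverse[OF prime_card padic_rel_sym[OF prime_card padic_seq_Padic[OF X]] assms] .
  hence "(Padic (\<lambda>n. inverse (X n)) :: 'p padic) = Padic (\<lambda>n. inverse (padic_seq (Padic X :: 'p padic) n))"
    by (rule Padic_eqI)
  thus ?thesis using assms by (simp add: inverse_padic_def Padic_eq_0_iff)
qed

lemma padic_norm_Padic_tendsto:
  "(\<lambda>n. padic_abs CARD('p) (X n)) \<longlonglongrightarrow> padic_norm (Padic X :: 'p padic)"
proof -
  have "padic_norm (Padic X :: 'p padic) = lim (\<lambda>n. padic_abs CARD('p) (X n))"
    unfolding padic_norm_def by (rule padic_rel_lim[OF prime_card padic_seq_Padic[OF X]])
  thus ?thesis
    using padic_cauchy_abs[OF prime_card X]
    by (simp add: Cauchy_convergent_iff convergent_LIMSEQ_iff)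
qed

end

instance padic :: (prime_card) field
proof
  note [simp] = prime_card[where ?'a = 'a]
  note ops = plus_Padic times_Padic uminus_Padic zero_padic_def one_padic_def
    padic_cauchy_add padic_cauchy_mult padic_cauchy_minus
  fix a b c :: "'a padic"
  show "a + b = b + a"
    by (simp add: plus_padic_def add.commute)
  show "(a + b) + c = a + (b + c)"
    by (induct a, induct b, induct c) (simp add: ops ac_simps)
  show "0 + a = a"
    by (induct a) (simp add: ops)
  show "- a + a = 0"
    by (induct a) (simp add: ops)
  show "a - b = a + - b"
    by (rule minus_padic_def)
  show "(a * b) * c = a * (b * c)"
    by (induct a, induct b, induct c) (simp add: ops ac_simps)
  show "a * b = b * a"
    by (simp add: times_padic_def mult.commute)
  show "1 * a = a"
    by (induct a) (simp add: ops)
  show "(a + b) * c = a * c + b * c"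
    by (induct a, induct b, induct c) (simp add: ops distrib_right)
  show "(0 :: 'a padic) \<noteq> 1"
    using Padic_eq_0_iff[of "\<lambda>n. 1", where ?'p = 'a] by (simp add: one_padic_def)
  show "inverse a * a = 1" if "a \<noteq> 0"
    using that
  proof (induct a)
    case (Padic X)
    note X = Padic(1)
    have nz: "\<not> padic_null CARD('a) X" using Padic by (simp add: Padic_eq_0_iff)
    obtain b k where b: "b > 0" "\<And>n. n \<ge> k \<Longrightarrow> b \<le> padic_abs CARD('a) (X n)"
      using padic_cauchy_not_null[OF _ X nz] by auto
    have "X n \<noteq> 0" if "n \<ge> k" for n using b(2)[OF that] b(1) by auto
    hence "padic_null CARD('a) (\<lambda>n. inverse (X n) * X n - 1)"
      unfolding padic_null_def by (intro allI impI exI[of _ k]) auto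
    thus ?case
      using X nz by (simp add: inverse_Padic times_Padic one_padic_def eq_Padic
          padic_cauchy_mult padic_cauchy_inverse)
  qed
  show "a div b = a * inverse b"
    by (rule divide_padic_def)
  show "inverse (0 :: 'a padic) = 0"
    by (simp add: inverse_padic_def)
qed

lemma of_nat_padic: "(of_nat m :: 'p::prime_card padic) = Padic (\<lambda>n. of_nat m)"
  by (induct m)
     (simp_all add: zero_padic_def one_padic_def plus_Padic prime_card)

instance padic :: (prime_card) field_char_0
proof
  show "inj (of_nat :: nat \<Rightarrow> 'a padic)"
  proof (rule injI)
    fix m n assume "(of_nat m :: 'a padic) = of_nat n"
    hence "padic_null CARD('a) (\<lambda>k. of_nat m - of_nat n)"
      by (simp only: of_nat_padic eq_Padic padic_cauchy_const[OF prime_card])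
    thus "m = n" by (simp add: prime_card)
  qed
qed

subsection \<open>The absolute value and the metric\<close>

lemma padic_norm_nonneg [simp]: "0 \<le> padic_norm (x :: 'p::prime_card padic)"
proof (induct x)
  case (Padic X)
  show ?case
    by (rule LIMSEQ_le_const[OF padic_norm_Padic_tendsto[OF Padic]]) (simp add: prime_card)
qed

lemma padic_norm_eq_0_iff [simp]: "padic_norm x = 0 \<longleftrightarrow> x = (0 :: 'p::prime_card padic)"
proof (induct x)
  case (Padic X)
  have "padic_norm (Padic X :: 'p padic) = 0 \<longleftrightarrow> padic_null CARD('p) X"
    using padic_norm_Padic_tendsto[OF Padic] LIMSEQ_unique by (metis padic_null_iff[OF prime_card])
  also have "\<dots> \<longleftrightarrow> (Padic X :: 'p padic) = Padic (\<lambda>n. 0)"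
    using eq_Padic[OF Padic, of "\<lambda>n. 0"] by (simp add: prime_card)
  finally show ?case by (simp add: zero_padic_def)
qed

lemma padic_norm_minus [simp]: "padic_norm (- x) = padic_norm (x :: 'p::prime_card padic)"
proof (induct x)
  case (Padic X)
  have "(\<lambda>n. padic_abs CARD('p) (- X n)) \<longlonglongrightarrow> padic_norm (- Padic X :: 'p padic)"
    unfolding uminus_Padic[OF Padic]
    by (rule padic_norm_Padic_tendsto) (rule padic_cauchy_minus[OF prime_card Padic])
  thus ?case
    using padic_norm_Padic_tendsto[OF Padic] LIMSEQ_unique by (fastforce simp: prime_card)
qed

lemma padic_norm_minus_commute: "padic_norm (x - y) = padic_norm (y - x :: 'p::prime_card padic)"
  using padic_norm_minus[of "y - x"] unfolding minus_diff_eq .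

lemma padic_norm_mult: "padic_norm (x * y) = padic_norm x * padic_norm (y :: 'p::prime_card padic)"
proof (induct x)
  case (Padic X)
  note X = this
  show ?case
  proof (induct y)
    case (Padic Y)
    have "(\<lambda>n. padic_abs CARD('p) (X n * Y n)) \<longlonglongrightarrow> padic_norm (Padic X * Padic Y :: 'p padic)"
      unfolding times_Padic[OF X Padic]
      by (rule padic_norm_Padic_tendsto) (rule padic_cauchy_mult[OF prime_card X Padic])
    moreover have "(\<lambda>n. padic_abs CARD('p) (X n * Y n))
        \<longlonglongrightarrow> padic_norm (Padic X :: 'p padic) * padic_norm (Padic Y :: 'p padic)"
      using tendsto_mult[OF padic_norm_Padic_tendsto[OF X] padic_norm_Padic_tendsto[OF Padic]]
      by (simp add: padic_abs_mult[OF prime_card])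
    ultimately show ?case by (rule LIMSEQ_unique)
  qed
qed

lemma padic_norm_add_le: "padic_norm (x + y) \<le> max (padic_norm x) (padic_norm (y :: 'p::prime_card padic))"
proof (induct x)
  case (Padic X)
  note X = this
  show ?case
  proof (induct y)
    case (Padic Y)
    have "(\<lambda>n. padic_abs CARD('p) (X n + Y n)) \<longlonglongrightarrow> padic_norm (Padic X + Padic Y :: 'p padic)"
      unfolding plus_Padic[OF X Padic]
      by (rule padic_norm_Padic_tendsto) (rule padic_cauchy_add[OF prime_card X Padic])
    thus ?case
      by (rule LIMSEQ_le[OF _ tendsto_max[OF padic_norm_Padic_tendsto[OF X] padic_norm_Padic_tendsto[OF Padic]]])
         (simp add: padic_abs_add_le prime_card)
  qed
qed

instantiation padic :: (prime_card) metric_space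
begin

definition dist_padic :: "'a padic \<Rightarrow> 'a padic \<Rightarrow> real" where
  "dist_padic x y = padic_norm (x - y)"

definition uniformity_padic :: "('a padic \<times> 'a padic) filter" where
  "uniformity_padic = (INF e\<in>{0 <..}. principal {(x, y). dist x y < e})"

definition open_padic :: "'a padic set \<Rightarrow> bool" where
  "open_padic U \<longleftrightarrow> (\<forall>x\<in>U. eventually (\<lambda>(x', y). x' = x \<longrightarrow> y \<in> U) uniformity)"

instance
proof
  fix x y z :: "'a padic"
  show "dist x y = 0 \<longleftrightarrow> x = y" by (simp add: dist_padic_def)
  have xy: "(x - z) + (z - y) = x - y" by simp
  show "dist x y \<le> dist x z + dist y z"
    using padic_norm_add_le[of "x - z" "z - y", unfolded xy] padic_norm_minus_commute[of z y]
      padic_norm_nonneg[of "x - z"] padic_norm_nonneg[of "z - y"]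
    unfolding dist_padic_def by linarith
qed (simp_all add: uniformity_padic_def open_padic_def)

end

text \<open>
  The next three facts say that \<open>'p padic\<close> is the completion of the rationals for
  \<^const>\<open>padic_abs\<close>.
\<close>

lemma of_rat_padic: "(of_rat q :: 'p::prime_card padic) = Padic (\<lambda>n. q)"
proof -
  note [simp] = prime_card[where ?'a = 'p]
  have i: "(of_int a :: 'p padic) = Padic (\<lambda>n. of_int a)" for a
    by (cases a rule: int_diff_cases)
       (simp add: of_nat_padic uminus_Padic plus_Padic diff_conv_add_uminus
          del: add_uminus_conv_diff)
  obtain a b where q: "q = of_int a / of_int b" "b > 0" by (rule rat_as_quotient)
  have "Padic (\<lambda>n. q) * (of_int b :: 'p padic) = of_int a"
    using q by (simp add: i times_Padic)
  hence "Padic (\<lambda>n. q) = (of_int a / of_int b :: 'p padic)"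
    using q(2) by (simp add: eq_divide_eq)
  thus ?thesis using q by (simp add: of_rat_divide)
qed

lemma padic_norm_of_rat: "padic_norm (of_rat q :: 'p::prime_card padic) = padic_abs CARD('p) q"
  using padic_norm_Padic_tendsto[of "\<lambda>n. q", where ?'p = 'p]
  by (simp add: of_rat_padic prime_card LIMSEQ_const_iff)

lemma of_rat_dense_padic:
  assumes "e > 0"
  shows "\<exists>q. padic_norm (x - of_rat q :: 'p::prime_card padic) < e"
proof (induct x)
  case (Padic X)
  note [simp] = prime_card[where ?'a = 'p]
  obtain k where k: "\<forall>m\<ge>k. \<forall>n\<ge>k. padic_abs CARD('p) (X m - X n) < e / 2"
    using padic_cauchyD[OF _ Padic, of "e / 2"] assms by auto
  have "(Padic X - of_rat (X k) :: 'p padic) = Padic (\<lambda>n. X n - X k)"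
    using Padic unfolding diff_conv_add_uminus
    by (simp add: of_rat_padic uminus_Padic plus_Padic del: add_uminus_conv_diff)
  moreover have "padic_cauchy CARD('p) (\<lambda>n. X n + - X k)"
    using Padic by (intro padic_cauchy_add) auto
  ultimately have "(\<lambda>n. padic_abs CARD('p) (X n - X k)) \<longlonglongrightarrow> padic_norm (Padic X - of_rat (X k) :: 'p padic)"
    using padic_norm_Padic_tendsto[of "\<lambda>n. X n - X k", where ?'p = 'p] by simp
  hence "padic_norm (Padic X - of_rat (X k) :: 'p padic) \<le> e / 2"
    by (rule LIMSEQ_le_const2) (use k in \<open>auto intro!: exI[of _ k] less_imp_le\<close>)
  hence "padic_norm (Padic X - of_rat (X k) :: 'p padic) < e" using assms by simp
  thus ?case ..
qed

instance padic :: (prime_card) complete_space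
proof
  note [simp] = prime_card[where ?'a = 'a]
  fix X :: "nat \<Rightarrow> 'a padic" assume X: "Cauchy X"
  have "\<exists>q. padic_norm (X n - of_rat q) < inverse (real (Suc n))" for n
    by (rule of_rat_dense_padic) simp
  then obtain q where q: "\<And>n. padic_norm (X n - of_rat (q n)) < inverse (real (Suc n))" by metis
  have tri: "padic_norm (x + y) < e" if "padic_norm x < e" "padic_norm y < e" for x y :: "'a padic" and e
    using padic_norm_add_le[of x y] that by linarith
  have small: "\<exists>k. \<forall>n\<ge>k. padic_norm (X n - of_rat (q n)) < e" if e: "e > 0" for e
  proof -
    obtain k where k: "inverse (real (Suc k)) < e" using reals_Archimedean[OF e] by blast
    have "padic_norm (X n - of_rat (q n)) < e" if "n \<ge> k" for n
    proof -
      have "inverse (real (Suc n)) \<le> inverse (real (Suc k))" using that by simp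
      thus ?thesis using q[of n] k by linarith
    qed
    thus ?thesis by blast
  qed
  have cq: "padic_cauchy CARD('a) q"
    unfolding padic_cauchy_def
  proof (intro allI impI)
    fix e :: real assume e: "e > 0"
    obtain i where i: "\<forall>m\<ge>i. \<forall>n\<ge>i. padic_norm (X m - X n) < e"
      using X e unfolding Cauchy_def dist_padic_def by blast
    obtain j where j: "\<forall>n\<ge>j. padic_norm (X n - of_rat (q n)) < e" using small[OF e] ..
    have "padic_abs CARD('a) (q m - q n) < e" if mn: "m \<ge> max i j" "n \<ge> max i j" for m n
    proof -
      have "padic_norm ((of_rat (q m) - X m) + ((X m - X n) + (X n - of_rat (q n)))) < e"
        using i j mn by (intro tri) (auto simp: padic_norm_minus_commute[of _ "X m"])
      thus ?thesis by (simp add: of_rat_diff flip: padic_norm_of_rat)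
    qed
    thus "\<exists>k. \<forall>m\<ge>k. \<forall>n\<ge>k. padic_abs CARD('a) (q m - q n) < e" by blast
  qed
  have "X \<longlonglongrightarrow> Padic q"
    unfolding LIMSEQ_def dist_padic_def
  proof (intro allI impI)
    fix e :: real assume e: "e > 0"
    obtain i where i: "\<forall>m\<ge>i. \<forall>n\<ge>i. padic_abs CARD('a) (q m - q n) < e / 2"
      using padic_cauchyD[OF _ cq, of "e / 2"] e by auto
    obtain j where j: "\<forall>n\<ge>j. padic_norm (X n - of_rat (q n)) < e" using small[OF e] ..
    have "padic_norm (X m - Padic q) < e" if m: "m \<ge> max i j" for m
    proof -
      have "(of_rat (q m) - Padic q :: 'a padic) = Padic (\<lambda>n. q m - q n)"
        using cq unfolding diff_conv_add_uminus
        by (simp add: of_rat_padic uminus_Padic plus_Padic padic_cauchy_minus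
              del: add_uminus_conv_diff)
      moreover have "padic_cauchy CARD('a) (\<lambda>n. q m + - q n)"
        using cq by (intro padic_cauchy_add padic_cauchy_minus) auto
      ultimately have "(\<lambda>n. padic_abs CARD('a) (q m - q n))
          \<longlonglongrightarrow> padic_norm (of_rat (q m) - Padic q :: 'a padic)"
        using padic_norm_Padic_tendsto[of "\<lambda>n. q m - q n", where ?'p = 'a] by simp
      hence "padic_norm (of_rat (q m) - Padic q :: 'a padic) \<le> e / 2"
        by (rule LIMSEQ_le_const2) (use i m in \<open>auto intro!: exI[of _ i] less_imp_le\<close>)
      hence "padic_norm ((X m - of_rat (q m)) + (of_rat (q m) - Padic q)) < e"
        using j m e by (intro tri) auto
      thus ?thesis by simp
    qed
    thus "\<exists>k. \<forall>n\<ge>k. padic_norm (X n - Padic q) < e" by blast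
  qed
  thus "convergent X" by (auto simp: convergent_def)
qed

definition padic_integers :: "'p::prime_card padic set" where
  "padic_integers = {x. padic_norm x \<le> 1}"

definition padic_cong :: "'p::prime_card padic \<Rightarrow> 'p padic \<Rightarrow> nat \<Rightarrow> bool" where
  "padic_cong a b n \<longleftrightarrow> (\<exists>c\<in>padic_integers. a - b = of_nat CARD('p) ^ n * c)"


section \<open>The symmetric Pascal matrix and the hypergeometric functions\<close>

definition pascal_mat :: "nat \<Rightarrow> rat mat" where
  "pascal_mat N = mat (N + 1) (N + 1) (\<lambda>(j, k). of_nat ((j + k) choose j))"

text \<open>
  The terminating series ${}_2F_1(-N/2, N/2+1; -N; x)$, meant for even \<open>N\<close>: the terms with
  \<open>N/2 < k \<le> N\<close> vanish, and those with \<open>k > N\<close>, formally \<open>0/0\<close>, are not part of it.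
\<close>

definition pascal_hyp :: "nat \<Rightarrow> 'a::field_char_0 \<Rightarrow> 'a" where
  "pascal_hyp N x = (\<Sum>k\<le>N div 2.
     pochhammer (- (of_nat N / 2)) k * pochhammer (of_nat N / 2 + 1) k
       / (pochhammer (- of_nat N) k * fact k) * x ^ k)"

definition pascal_U :: "nat \<Rightarrow> 'a::field_char_0 \<Rightarrow> 'a" where
  "pascal_U N z = pascal_hyp N z * pascal_hyp N (z / (z - 1)) * (1 - z) ^ (N div 2)"

definition hyp2F1 :: "'a \<Rightarrow> 'a \<Rightarrow> 'a \<Rightarrow> 'a \<Rightarrow> 'a::{field_char_0, metric_space}" where
  "hyp2F1 a b c z = (\<Sum>k. pochhammer a k * pochhammer b k / (pochhammer c k * fact k) * z ^ k)"

end

theory Submission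
  imports Defs "HOL-Computational_Algebra.Polynomial_FPS"
begin

text \<open>
  Write \<open>N = p^n - 1 = 2 m\<close>, \<open>h\<close> for the polynomial ${}_2F_1(-m, m+1; -2m; x)$, and
  \<open>k(x) = (1 - x)^m h(x / (x - 1))\<close>, so that \<open>U_n = h k\<close>.

  \<^emph>\<open>The eigenvector.\<close> The column generating functions of the Pascal matrix are
  \<open>(1 - X)^(- i - 1)\<close>, so a vector with reversed generating polynomial \<open>W\<close> is mapped to the first
  \<open>N + 1\<close> coefficients of \<open>(1 - X)^(- N - 1) W(1 - X)\<close>. For \<open>W = h k\<close> three symmetries evaluate
  this series: \<open>h\<close> is palindromic, hence \<open>k(1 - x) = (-1)^m k(x)\<close>
  (\<open>pfaff_poly_reflect\<close>) and the reversal of \<open>h k\<close> is \<open>(-1)^m h(x) h(1 - x)\<close>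
  (\<open>eigen_coeff_poly\<close>); and Euler's transformation holds modulo \<open>X^(N + 1)\<close>:
  \<open>(1 - X)^(- N - 1) k(X)\<close> agrees there with \<open>h(X)\<close> (\<open>euler_transformation\<close>). Together they give
  back the vector itself (\<open>eigen_coeff_fixed\<close>).

  \<^emph>\<open>Uniqueness.\<close> It suffices that a fixed vector \<open>v\<close> with last entry \<open>0\<close> vanishes
  (\<open>pascal_fixed_last_0\<close>). The Pascal matrix acts by iterated partial summation, which does not
  increase the number of sign changes. Were \<open>v\<close> nonzero, adding a small multiple of a basis vector
  at a position \<open>i\<close> with \<open>v i \<noteq> 0\<close> would keep the sign changes of \<open>v\<close>, but the image of the
  perturbed vector would have a nonzero last entry, whose sign can be chosen to create one further
  sign change.

  \<^emph>\<open>The congruence.\<close> By Pfaff's transformation \<open>k\<close> is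
  ${}_2F_1(-m, -3m-1; -2m; x)$. With \<open>q = p^n\<close> the parameters of \<open>h\<close> and \<open>k\<close> are
  \<open>(1 - q)/2\<close>, \<open>(1 + t q)/2\<close> and \<open>1 - q\<close> with \<open>t = 1\<close> and \<open>t = - 3\<close>, so both are
  perturbations of \<open>F\<close>. The \<open>j\<close>-th coefficient differs from that of \<open>F\<close> by a factor which is a
  product of terms \<open>1 + O(q / i)\<close> with \<open>i < 2 j \<le> p^j\<close>; the loss \<open>p^j\<close> is made up by
  \<open>z^j\<close>, because \<open>z\<close> is divisible by \<open>p\<close>. So \<open>h(z)\<close> and \<open>k(z)\<close> are both congruent to
  \<open>F(z)\<close> modulo \<open>p^n\<close> (\<open>hyp_poly_congruence\<close>), and their product is congruent to \<open>F(z)^2\<close>.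
\<close>

section \<open>Sign changes under partial summation\<close>

text \<open>
  The first argument is the last nonzero entry read so far, and \<open>0\<close> before any has been read; in this
  form the count of a concatenation is determined by a state that is a single number.
\<close>
fun sign_changes :: "'a::linordered_idom \<Rightarrow> 'a list \<Rightarrow> nat" where
  "sign_changes a [] = 0"
| "sign_changes a (x # xs) =
     (if x = 0 then sign_changes a xs else (if a * x < 0 then 1 else 0) + sign_changes x xs)"

fun psums :: "'a::monoid_add \<Rightarrow> 'a list \<Rightarrow> 'a list" where
  "psums c [] = []"
| "psums c (x # xs) = (c + x) # psums (c + x) xs"

text \<open>
  A partial sum can change sign only after the summands have done so. The induction needs the state
  of both counts: \<open>a\<close> and \<open>b\<close> are the last nonzero summand and the last nonzero partial sum, \<open>c\<close> is the
  current partial sum, and opposite signs of \<open>a\<close> and \<open>b\<close> mean that the summands are one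
  change ahead.
\<close>
lemma sign_changes_psums:
  assumes "c = 0 \<or> c * b > 0" "a = 0 \<longrightarrow> b = 0"
  shows "sign_changes b (psums c xs) \<le> sign_changes a xs + (if a * b < 0 then 1 else 0)"
  using assms
proof (induction xs arbitrary: a b c)
  case (Cons x xs)
  define d where "d = c + x"
  define a' where "a' = (if x = 0 then a else x)"
  define b' where "b' = (if d = 0 then b else d)"
  have "sign_changes b' (psums d xs) \<le> sign_changes a' xs + (if a' * b' < 0 then 1 else 0)"
    by (rule Cons.IH) (use Cons.prems in \<open>auto simp: a'_def b'_def d_def not_square_less_zero 
      simp flip: power2_eq_square\<close>)
  moreover have "(if d \<noteq> 0 \<and> b * d < 0 then 1 else 0) + (if a' * b' < 0 then 1 else 0)
     \<le> (if x \<noteq> 0 \<and> a * x < 0 then 1 else 0) + (if a * b < 0 then 1 else (0::nat))"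
    using Cons.prems unfolding a'_def b'_def d_def
    by (auto simp: mult_less_0_iff zero_less_mult_iff)
  ultimately show ?case
    by (auto simp: d_def[symmetric] a'_def b'_def split: if_splits)
qed auto

lemma sign_changes_start:
  "b \<noteq> 0 \<Longrightarrow> sign_changes a xs \<le> sign_changes b xs + (if a * b < 0 then 1 else 0)"
  by (induction xs) (auto simp: mult_less_0_iff)

lemma sign_changes_Cons_ge: "sign_changes a xs \<le> sign_changes a (x # xs)"
  using sign_changes_start[of x a xs] by auto

text \<open>
  Zero entries carry no sign changes, so replacing them by arbitrary values can only add some.
\<close>
lemma sign_changes_fill:
  assumes "list_all2 (\<lambda>x y. x \<noteq> 0 \<longrightarrow> x * y > 0) xs ys" "a \<noteq> 0 \<longrightarrow> a * b > 0"
  shows "sign_changes a xs \<le> sign_changes b ys"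
  using assms
proof (induction xs ys arbitrary: a b rule: list_all2_induct)
  case (Cons x xs y ys)
  show ?case
  proof (cases "x = 0")
    case True
    have "sign_changes a xs \<le> sign_changes b ys" using Cons by blast
    also have "\<dots> \<le> sign_changes b (y # ys)" by (rule sign_changes_Cons_ge)
    finally show ?thesis using True by simp
  next
    case False
    have "sign_changes x xs \<le> sign_changes y ys" using Cons False by blast
    moreover have "y \<noteq> 0" "a * x < 0 \<longrightarrow> b * y < 0"
      using Cons False by (auto simp: mult_less_0_iff zero_less_mult_iff)
    ultimately show ?thesis using False by auto
  qed
qed auto

text \<open>
  The witness is the negative of the last nonzero entry.
\<close>
lemma sign_changes_extend:
  assumes "a \<noteq> 0 \<or> (\<exists>x\<in>set xs. x \<noteq> 0)"
  shows "\<exists>s. s \<noteq> 0 \<and> sign_changes a (xs @ [s]) = Suc (sign_changes a xs)"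
  using assms
proof (induction xs arbitrary: a)
  case Nil
  thus ?case by (intro exI[of _ "- a"]) (auto simp: mult_less_0_iff zero_less_mult_iff linorder_neq_iff)
next
  case (Cons x xs)
  show ?case
  proof (cases "x = 0")
    case True
    then obtain s where "s \<noteq> 0" "sign_changes a (xs @ [s]) = Suc (sign_changes a xs)"
      using Cons.IH[of a] Cons.prems by auto
    thus ?thesis using True by (intro exI[of _ s]) simp
  next
    case False
    then obtain s where "s \<noteq> 0" "sign_changes x (xs @ [s]) = Suc (sign_changes x xs)"
      using Cons.IH[of x] by auto
    thus ?thesis using False by (intro exI[of _ s]) simp
  qed
qed

lemma sign_changes_append_0 [simp]: "sign_changes a (xs @ [0]) = sign_changes a xs"
  by (induction xs arbitrary: a) auto

section \<open>Vectors fixed by the Pascal matrix\<close>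

text \<open>
  The first \<open>l\<close> entries of the image of a vector under the infinite Pascal matrix. The recursion is
  Horner's rule for \<open>\<Sum>k. v k * (1 - X) ^ (- k - 1)\<close>: adding \<open>v\<close> to the constant term and dividing by
  \<open>1 - X\<close> is partial summation started at \<open>v\<close>.
\<close>
fun pascal_list :: "nat \<Rightarrow> 'a::linordered_idom list \<Rightarrow> 'a list" where
  "pascal_list l [] = replicate l 0"
| "pascal_list l (v # vs) = psums v (pascal_list l vs)"

text \<open>
  This is the variation diminishing property of the totally positive Pascal matrix; Horner's rule
  replaces a factorisation into bidiagonal matrices.
\<close>
lemma sign_changes_pascal_list: "sign_changes a (pascal_list l vs) \<le> sign_changes a vs"
proof (induction vs arbitrary: a)
  case Nil
  show ?case by (induction l) auto
next
  case (Cons v vs)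
  have "sign_changes a (pascal_list l (v # vs)) \<le> sign_changes a (psums 0 (v # pascal_list l vs))"
    using sign_changes_Cons_ge[of a _ v] by simp
  also have "\<dots> \<le> sign_changes a (v # pascal_list l vs)"
    using sign_changes_psums[of 0 a a "v # pascal_list l vs"]
    by (simp add: not_square_less_zero del: psums.simps sign_changes.simps)
  also have "\<dots> \<le> sign_changes a (v # vs)" using Cons.IH by simp
  finally show ?case .
qed

lemma length_psums [simp]: "length (psums c xs) = length xs"
  by (induction xs arbitrary: c) auto

lemma nth_psums:
  fixes c :: "'a::comm_monoid_add"
  shows "j < length xs \<Longrightarrow> psums c xs ! j = c + (\<Sum>i\<le>j. xs ! i)"
proof (induction xs arbitrary: c j)
  case (Cons x xs)
  show ?case
  proof (cases j)
    case (Suc i)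
    thus ?thesis using Cons
      by (simp add: sum.atMost_Suc_shift add.assoc del: sum.atMost_Suc)
  qed simp
qed simp

lemma length_pascal_list [simp]: "length (pascal_list l vs) = l"
  by (induction vs) auto

lemma nth_pascal_list:
  "j < l \<Longrightarrow> pascal_list l vs ! j = (\<Sum>k<length vs. of_nat ((j + k) choose j) * vs ! k)"
proof (induction vs arbitrary: j)
  case (Cons v vs)
  have sym: "(i + k) choose i = (k + i) choose k" for i k :: nat
    using binomial_symmetric[of i "i + k"] by (simp add: add.commute)
  have "pascal_list l (v # vs) ! j
      = v + (\<Sum>i\<le>j. \<Sum>k<length vs. of_nat ((i + k) choose i) * vs ! k)"
    using Cons by (simp add: nth_psums)
  also have "(\<Sum>i\<le>j. \<Sum>k<length vs. of_nat ((i + k) choose i) * vs ! k)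
      = (\<Sum>k<length vs. of_nat (\<Sum>i\<le>j. (k + i) choose k) * vs ! k)"
    by (subst sum.swap) (simp add: sum_distrib_right sym)
  also have "\<dots> = (\<Sum>k<length vs. of_nat ((j + Suc k) choose j) * vs ! k)"
    unfolding choose_rising_sum using sym[of j "Suc _"] by simp
  finally show ?case by (simp add: sum.lessThan_Suc_shift del: sum.lessThan_Suc)
qed simp

lemma small_multiple:
  fixes f c :: "'b \<Rightarrow> 'a::linordered_field"
  assumes "finite A" "\<And>x. x \<in> A \<Longrightarrow> f x > 0"
  shows "\<exists>e>0. \<forall>x\<in>A. e * c x < f x"
  using assms
proof (induction rule: finite_induct)
  case empty
  show ?case by (intro exI[of _ 1]) auto
next
  case (insert y A)
  then obtain e where e: "e > 0" "\<forall>x\<in>A. e * c x < f x" by auto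
  define d where "d = (if c y \<le> 0 then e else min e (f y / (2 * c y)))"
  have f: "f y > 0" using insert by auto
  have d: "d > 0" "d \<le> e" using e f by (auto simp: d_def)
  have "d * c y < f y"
  proof (cases "c y \<le> 0")
    case True
    hence "d * c y \<le> 0" using d by (simp add: mult_le_0_iff)
    thus ?thesis using f by linarith
  next
    case False
    have "d * c y \<le> f y / (2 * c y) * c y"
      using False by (intro mult_right_mono) (auto simp: d_def)
    also have "\<dots> < f y" using False f by (simp add: field_simps)
    finally show ?thesis .
  qed
  moreover have "d * c x < f x" if "x \<in> A" for x
  proof (cases "c x \<le> 0")
    case True
    hence "d * c x \<le> 0" using d by (simp add: mult_le_0_iff)
    thus ?thesis using insert.prems[of x] that by auto
  next
    case False
    hence "d * c x \<le> e * c x" using d by (intro mult_right_mono) auto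
    thus ?thesis using e that by fastforce
  qed
  ultimately show ?case using d by blast
qed

text \<open>
  Total positivity makes the eigenvalue simple. In the proof \<open>xs\<close> is \<open>v\<close> without its
  last entry and \<open>s\<close> has the sign that would extend \<open>xs\<close> by a sign change. Perturbing \<open>v\<close> at \<open>k\<close> to \<open>w\<close>
  moves the image \<open>g\<close> at the last position from \<open>0\<close> to the sign of \<open>s\<close>, so \<open>g\<close> has more
  sign changes than \<open>w\<close>.
\<close>
lemma pascal_fixed_last_0:
  fixes v :: "nat \<Rightarrow> rat"
  assumes fixed: "\<And>j. j \<le> N \<Longrightarrow> (\<Sum>k\<le>N. of_nat ((j + k) choose j) * v k) = v j"
    and last: "v N = 0" and k: "k \<le> N"
  shows "v k = 0"
proof (rule ccontr)
  assume vk: "v k \<noteq> 0"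
  define xs where "xs = map v [0..<N]"
  have kN: "k < N" using k vk last by (cases "k = N") auto
  hence "\<exists>x\<in>set xs. x \<noteq> 0" using vk by (auto simp: xs_def)
  then obtain s where s: "s \<noteq> 0" "sign_changes 0 (xs @ [s]) = Suc (sign_changes 0 xs)"
    using sign_changes_extend by blast
  define C where "C j = (of_nat ((j + k) choose j) :: rat)" for j
  have C: "C j \<ge> 1" for j unfolding C_def by (simp add: Suc_leI)
  \<comment> \<open>The size of the perturbation keeps the sign of every nonzero entry of \<open>v\<close>, both in the vector and in its image.\<close>
  have "\<exists>e>0. \<forall>j\<in>{j. j \<le> N \<and> v j \<noteq> 0}. e * (\<bar>s\<bar> * C j) < \<bar>v j\<bar>"
    by (rule small_multiple) auto
  then obtain e where e: "e > 0" "\<And>j. j \<le> N \<Longrightarrow> v j \<noteq> 0 \<Longrightarrow> e * (\<bar>s\<bar> * C j) < \<bar>v j\<bar>" by auto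
  define w where "w j = v j + (if j = k then e * s else 0)" for j
  define ws where "ws = map w [0..<Suc N]"
  define g where "g j = v j + e * s * C j" for j
  have near: "x * (x + y) > 0" if "\<bar>y\<bar> < \<bar>x\<bar>" for x y :: rat
    using that by (auto simp: zero_less_mult_iff abs_if split: if_splits)
  have g: "pascal_list (Suc N) ws = map g [0..<Suc N]"
  proof (rule nth_equalityI)
    fix j assume "j < length (pascal_list (Suc N) ws)"
    hence j: "j \<le> N" by simp
    have "pascal_list (Suc N) ws ! j = (\<Sum>i<Suc N. of_nat ((j + i) choose j) * w i)"
      using j by (subst nth_pascal_list) (auto simp: ws_def simp del: upt_Suc)
    also have "\<dots> = (\<Sum>i\<le>N. of_nat ((j + i) choose j) * v i)
        + (\<Sum>i\<le>N. of_nat ((j + i) choose j) * (if i = k then e * s else 0))"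
      unfolding w_def lessThan_Suc_atMost by (simp add: ring_distribs sum.distrib)
    also have "(\<Sum>i\<le>N. of_nat ((j + i) choose j) * (if i = k then e * s else 0)) = e * s * C j"
      using k by (simp add: if_distrib cong: if_cong) (simp add: C_def)
    finally show "pascal_list (Suc N) ws ! j = map g [0..<Suc N] ! j"
      using j fixed[OF j] by (simp add: g_def del: upt_Suc)
  qed simp
  have vg: "v j * g j > 0" if "j \<le> N" "v j \<noteq> 0" for j
    unfolding g_def using e(1) e(2)[OF that] C[of j] by (intro near) (auto simp: abs_mult)
  have vw: "w j * v j > 0" if "j \<le> N" "w j \<noteq> 0" for j
  proof (cases "j = k")
    case True
    have "\<bar>e * s\<bar> = e * \<bar>s\<bar> * 1" using e(1) by (simp add: abs_mult)
    also have "\<dots> \<le> e * \<bar>s\<bar> * C k" using C e(1) by (intro mult_left_mono) auto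
    also have "\<dots> < \<bar>v k\<bar>" using e(2)[OF k vk] by (simp add: mult.assoc)
    finally have "\<bar>e * s\<bar> < \<bar>v k\<bar>" .
    thus ?thesis using True near[of "e * s" "v k"] by (simp add: w_def mult.commute)
  qed (use that in \<open>auto simp: w_def not_square_less_zero zero_less_mult_iff\<close>)
  have "Suc (sign_changes 0 xs) = sign_changes 0 (xs @ [s])" using s by simp
  also have "\<dots> \<le> sign_changes 0 (map g [0..<N] @ [g N])"
  proof (rule sign_changes_fill)
    have "s * g N = e * C N * s\<^sup>2" using last by (simp add: g_def power2_eq_square)
    also have "\<dots> > 0" using s(1) e(1) C[of N] by (intro mult_pos_pos) auto
    finally show "list_all2 (\<lambda>x y. x \<noteq> 0 \<longrightarrow> x * y > 0) (xs @ [s]) (map g [0..<N] @ [g N])"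
      using vg by (intro list_all2_appendI) (auto simp: xs_def list_all2_conv_all_nth)
  qed simp
  also have "\<dots> = sign_changes 0 (pascal_list (Suc N) ws)" by (simp add: g)
  also have "\<dots> \<le> sign_changes 0 ws" by (rule sign_changes_pascal_list)
  also have "\<dots> \<le> sign_changes 0 (map v [0..<Suc N])"
    by (rule sign_changes_fill) (auto simp: ws_def list_all2_conv_all_nth vw simp del: upt_Suc)
  also have "\<dots> = sign_changes 0 xs" using last by (simp add: xs_def)
  finally show False by simp
qed

section \<open>Transformations of hypergeometric polynomials\<close>

definition hyp_coeff :: "'a \<Rightarrow> 'a \<Rightarrow> 'a \<Rightarrow> nat \<Rightarrow> 'a::field_char_0" where
  "hyp_coeff a b c k = pochhammer a k * pochhammer b k / (pochhammer c k * fact k)"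

text \<open>
  Up to signs, the terms are those of the binomial theorem for rising factorials with second
  argument \<open>1 - c - i\<close>, since \<open>(c + j)_(i - j)\<close> read backwards is \<open>(1 - c - i)_(i - j)\<close>.
\<close>
lemma chu_vandermonde:
  fixes b c :: "'a::field_char_0"
  assumes "pochhammer c i \<noteq> 0"
  shows "(\<Sum>j\<le>i. of_nat (i choose j) * (- 1) ^ j * pochhammer b j / pochhammer c j)
       = pochhammer (c - b) i / pochhammer c i"
proof -
  have "(\<Sum>j\<le>i. of_nat (i choose j) * (- 1) ^ j * pochhammer b j / pochhammer c j)
      = (\<Sum>j\<le>i. (- 1) ^ i * (of_nat (i choose j) * pochhammer b j
           * pochhammer (1 - c - of_nat i) (i - j))) / pochhammer c i"
    unfolding sum_divide_distrib
  proof (intro sum.cong refl)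
    fix j assume "j \<in> {..i}"
    hence j: "j \<le> i" by simp
    have c: "pochhammer c i = pochhammer c j * pochhammer (c + of_nat j) (i - j)"
      by (rule pochhammer_product[OF j])
    have "pochhammer (c + of_nat j) (i - j) = pochhammer (- (- c - of_nat j)) (i - j)" by (simp add: add.commute)
    also have "\<dots> = (- 1) ^ (i - j) * pochhammer (1 - c - of_nat i) (i - j)"
      unfolding pochhammer_minus using j by (simp add: of_nat_diff algebra_simps)
    finally have d: "pochhammer (c + of_nat j) (i - j) = \<dots>" .
    have s: "(- 1) ^ i = (- 1) ^ j * ((- 1) ^ (i - j) :: 'a)"
      using j by (simp flip: power_add)
    show "of_nat (i choose j) * (- 1) ^ j * pochhammer b j / pochhammer c j
        = (- 1) ^ i * (of_nat (i choose j) * pochhammer b j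
           * pochhammer (1 - c - of_nat i) (i - j)) / pochhammer c i"
      using assms unfolding c d s by simp
  qed
  also have "\<dots> = (- 1) ^ i * pochhammer (b + (1 - c - of_nat i)) i / pochhammer c i"
    by (simp only: pochhammer_binomial_sum sum_distrib_left)
  also have "(- 1) ^ i * pochhammer (b + (1 - c - of_nat i)) i = pochhammer (- (b - c)) i"
    unfolding pochhammer_minus by (simp add: algebra_simps)
  finally show ?thesis by simp
qed

lemma pochhammer_neg_of_nat:
  "pochhammer (- of_nat m) k = (- 1) ^ k * (fact k * of_nat (m choose k) :: 'a::field_char_0)"
  by (simp add: binomial_gbinomial gbinomial_pochhammer flip: power_mult_distrib mult.assoc)

lemma pochhammer_neg_nonzero:
  "k \<le> m \<Longrightarrow> pochhammer (- of_nat m :: 'a::field_char_0) k \<noteq> 0"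
  by (simp add: pochhammer_neg_of_nat)

text \<open>
  Pfaff's transformation in the terminating case, multiplied by \<open>(1 - z) ^ m\<close>: expanding the powers of
  \<open>1 - z\<close> leaves a Chu-Vandermonde sum in each coefficient.
\<close>
lemma pfaff_transformation:
  fixes z b c :: "'a::field_char_0"
  assumes "pochhammer c m \<noteq> 0"
  shows "(\<Sum>j\<le>m. hyp_coeff (- of_nat m) b c j * (- 1) ^ j * z ^ j * (1 - z) ^ (m - j))
       = (\<Sum>i\<le>m. hyp_coeff (- of_nat m) (c - b) c i * z ^ i)"
proof -
  have h: "hyp_coeff (- of_nat m) b c j * (- 1) ^ j
      = of_nat (m choose j) * pochhammer b j / pochhammer c j" for b j
    by (simp add: hyp_coeff_def pochhammer_neg_of_nat)
  define f where "f j i = of_nat (m choose j) * pochhammer b j / pochhammer c j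
      * (of_nat ((m - j) choose (i - j)) * (- 1) ^ (i - j)) * z ^ i" for i j
  have "hyp_coeff (- of_nat m) b c j * (- 1) ^ j * z ^ j * (1 - z) ^ (m - j) = (\<Sum>i=j..m. f j i)"
    if j: "j \<le> m" for j
  proof -
    have "(1 - z) ^ (m - j) = (\<Sum>l\<le>m - j. of_nat ((m - j) choose l) * (- z) ^ l)"
      using binomial_ring[of "- z" 1 "m - j"] by (simp add: mult_ac)
    hence "z ^ j * (1 - z) ^ (m - j)
        = (\<Sum>l=0..m - j. of_nat ((m - j) choose l) * (- 1) ^ l * z ^ (l + j))"
      by (simp add: sum_distrib_left power_add power_minus[of z] mult_ac atLeast0AtMost)
    also have "\<dots> = (\<Sum>i=j..m. of_nat ((m - j) choose (i - j)) * (- 1) ^ (i - j) * z ^ i)"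
      using sum.shift_bounds_cl_nat_ivl[of
          "\<lambda>i. of_nat ((m - j) choose (i - j)) * (- 1) ^ (i - j) * z ^ i" 0 j "m - j"] j by simp
    finally have *: "z ^ j * (1 - z) ^ (m - j)
        = (\<Sum>i=j..m. of_nat ((m - j) choose (i - j)) * (- 1) ^ (i - j) * z ^ i)" .
    show ?thesis unfolding mult.assoc[of _ "z ^ j"] h * f_def sum_distrib_left
      by (intro sum.cong refl) (simp only: mult.assoc)
  qed
  hence "(\<Sum>j\<le>m. hyp_coeff (- of_nat m) b c j * (- 1) ^ j * z ^ j * (1 - z) ^ (m - j))
      = (\<Sum>j=0..m. \<Sum>i=j..m. f j i)"
    by (simp add: atLeast0AtMost)
  also have "\<dots> = (\<Sum>i=0..m. \<Sum>j=0..i. f j i)"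
    unfolding sum.Sigma[OF finite_atLeastAtMost ballI[OF finite_atLeastAtMost]]
    by (rule sum.reindex_bij_witness[of _ "\<lambda>(i, j). (j, i)" "\<lambda>(i, j). (j, i)"]) auto
  also have "\<dots> = (\<Sum>i\<le>m. hyp_coeff (- of_nat m) (c - b) c i * z ^ i)"
    unfolding atLeast0AtMost
  proof (intro sum.cong refl)
    fix i assume "i \<in> {..m}"
    hence i: "i \<le> m" by simp
    have nz: "pochhammer c i \<noteq> 0"
      using assms pochhammer_product[OF i, of c] by auto
    have "(\<Sum>j\<le>i. f j i) = (\<Sum>j\<le>i. (- 1) ^ i * of_nat (m choose i) * z ^ i *
        (of_nat (i choose j) * (- 1) ^ j * pochhammer b j / pochhammer c j))"
    proof (intro sum.cong refl)
      fix j assume "j \<in> {..i}"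
      hence j: "j \<le> i" by simp
      have "of_nat (m choose j) * of_nat ((m - j) choose (i - j))
          = (of_nat (m choose i) * of_nat (i choose j) :: 'a)"
        unfolding of_nat_mult[symmetric] choose_mult[OF j i] ..
      moreover have "(- 1) ^ (i - j) = (- 1) ^ i * ((- 1) ^ j :: 'a)"
        using j by (auto simp: minus_one_power_iff)
      ultimately show "f j i = (- 1) ^ i * of_nat (m choose i) * z ^ i *
          (of_nat (i choose j) * (- 1) ^ j * pochhammer b j / pochhammer c j)"
        unfolding f_def by (simp add: mult_ac) 
    qed
    also have "\<dots> = (- 1) ^ i * of_nat (m choose i) * z ^ i * (pochhammer (c - b) i / pochhammer c i)"
      by (simp only: chu_vandermonde[OF nz] flip: sum_distrib_left)
    also have "\<dots> = hyp_coeff (- of_nat m) (c - b) c i * z ^ i"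
      by (simp add: hyp_coeff_def pochhammer_neg_of_nat)
    finally show "(\<Sum>j\<le>i. f j i) = \<dots>" .
  qed
  finally show ?thesis .
qed

text \<open>
  The other Pfaff transformation, with the roles of the two upper parameters exchanged, coefficient by
  coefficient: the quotient is the coefficient of \<open>X ^ (i - j)\<close> in \<open>(1 - X)\<close> to the power \<open>- b - j\<close>.
  Only \<open>pochhammer c i \<noteq> 0\<close> is required, so the identity survives for \<open>c = - 2 m\<close> up to \<open>i = 2 m\<close>,
  although the full series does not exist there.
\<close>
lemma pfaff_coefficients:
  fixes a b c :: "'a::field_char_0"
  assumes "pochhammer c i \<noteq> 0"
  shows "(\<Sum>j\<le>i. hyp_coeff a b c j * (- 1) ^ j * (pochhammer (b + of_nat j) (i - j) / fact (i - j)))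
       = hyp_coeff (c - a) b c i"
proof -
  have "hyp_coeff a b c j * (- 1) ^ j * (pochhammer (b + of_nat j) (i - j) / fact (i - j))
      = pochhammer b i / fact i * (of_nat (i choose j) * (- 1) ^ j * pochhammer a j / pochhammer c j)"
    if j: "j \<le> i" for j
    unfolding hyp_coeff_def pochhammer_product[OF j, of b] binomial_fact[OF j]
    by (simp add: mult_ac)
  hence "(\<Sum>j\<le>i. hyp_coeff a b c j * (- 1) ^ j * (pochhammer (b + of_nat j) (i - j) / fact (i - j)))
      = (\<Sum>j\<le>i. pochhammer b i / fact i
           * (of_nat (i choose j) * (- 1) ^ j * pochhammer a j / pochhammer c j))"
    by (intro sum.cong refl) auto
  also have "\<dots> = pochhammer b i / fact i * (pochhammer (c - a) i / pochhammer c i)"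
    by (simp only: chu_vandermonde[OF assms] flip: sum_distrib_left)
  finally have "(\<Sum>j\<le>i. hyp_coeff a b c j * (- 1) ^ j * (pochhammer (b + of_nat j) (i - j) / fact (i - j)))
      = pochhammer b i / fact i * (pochhammer (c - a) i / pochhammer c i)" .
  thus ?thesis by (simp add: hyp_coeff_def mult_ac)
qed

section \<open>The two factors of the generating function\<close>

lemma pochhammer_of_nat_plus_1:
  "pochhammer (of_nat m + 1) k = (fact (m + k) / fact m :: 'a::field_char_0)"
proof -
  have "(fact (m + k) :: 'a) = fact m * pochhammer (of_nat m + 1) k"
    unfolding pochhammer_fact pochhammer_product' by (simp only: add.commute)
  thus ?thesis by simp
qed

definition pascal_coeff :: "nat \<Rightarrow> nat \<Rightarrow> 'a::field_char_0" where
  "pascal_coeff m = hyp_coeff (- of_nat m) (of_nat m + 1) (- of_nat (2 * m))"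

text \<open>
  In this form the symmetry under \<open>k \<mapsto> m - k\<close> can be read off.
\<close>
lemma pascal_coeff_fact:
  assumes "k \<le> m"
  shows "pascal_coeff m k = (fact (m + k) * fact (2 * m - k)
     / (fact (m - k) * fact k * fact (2 * m)) :: 'a::field_char_0)"
proof -
  have k: "k \<le> 2 * m" using assms by simp
  show ?thesis
    unfolding pascal_coeff_def hyp_coeff_def pochhammer_neg_of_nat pochhammer_of_nat_plus_1
      binomial_fact[OF assms] binomial_fact[OF k]
    by (simp add: divide_simps del: fact_Suc)
qed

lemma pascal_coeff_palindromic:
  assumes "k \<le> m"
  shows "pascal_coeff m (m - k) = (pascal_coeff m k :: 'a::field_char_0)"
proof -
  have "m + (m - k) = 2 * m - k" "2 * m - (m - k) = m + k" using assms by auto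
  thus ?thesis using assms by (simp add: pascal_coeff_fact mult_ac)
qed

lemma pascal_coeff_eq_0: "m < k \<Longrightarrow> pascal_coeff m k = (0 :: 'a::field_char_0)"
  by (simp add: pascal_coeff_def hyp_coeff_def pochhammer_neg_of_nat)

text \<open>
  The coefficients of \<open>(1 - z) ^ m\<close> times \<open>pascal_hyp (2 * m) (z / (z - 1))\<close>: Pfaff's transformation
  replaces the parameter \<open>m + 1\<close> by \<open>- 2 m - (m + 1)\<close>.
\<close>
definition pfaff_coeff :: "nat \<Rightarrow> nat \<Rightarrow> 'a::field_char_0" where
  "pfaff_coeff m = hyp_coeff (- of_nat m) (- of_nat (3 * m + 1)) (- of_nat (2 * m))"

lemma pfaff_coeff_eq_0: "m < k \<Longrightarrow> pfaff_coeff m k = (0 :: 'a::field_char_0)"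
  by (simp add: pfaff_coeff_def hyp_coeff_def pochhammer_neg_of_nat)

lemma pfaff_coeff_sum:
  fixes z :: "'a::field_char_0"
  shows "(\<Sum>i\<le>m. pfaff_coeff m i * z ^ i)
    = (\<Sum>j\<le>m. pascal_coeff m j * (- 1) ^ j * z ^ j * (1 - z) ^ (m - j))"
proof -
  have c: "- of_nat (3 * m + 1) = - of_nat (2 * m) - (of_nat m + 1 :: 'a)" by simp
  show ?thesis
    unfolding pfaff_coeff_def pascal_coeff_def c
    by (rule pfaff_transformation[symmetric], rule pochhammer_neg_nonzero) simp
qed

lemma pascal_hyp_eq: "pascal_hyp (2 * m) z = (\<Sum>k\<le>m. pascal_coeff m k * z ^ k)"
  by (simp add: pascal_hyp_def pascal_coeff_def hyp_coeff_def)

lemma pascal_U_eq: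
  fixes z :: "'a::field_char_0"
  assumes "z \<noteq> 1"
  shows "pascal_U (2 * m) z = pascal_hyp (2 * m) z * (\<Sum>i\<le>m. pfaff_coeff m i * z ^ i)"
proof -
  have "pascal_coeff m k * (z / (z - 1)) ^ k * (1 - z) ^ m
      = pascal_coeff m k * (- 1) ^ k * z ^ k * (1 - z) ^ (m - k)" if k: "k \<le> m" for k
  proof -
    have "z / (z - 1) * (1 - z) = - 1 * z" using assms by (simp add: field_simps)
    hence "(z / (z - 1)) ^ k * (1 - z) ^ k = (- 1) ^ k * z ^ k"
      by (simp only: flip: power_mult_distrib)
    moreover have "(1 - z) ^ m = (1 - z) ^ k * (1 - z) ^ (m - k)"
      using k by (simp flip: power_add)
    ultimately show ?thesis by (simp add: mult_ac)
  qed
  hence "pascal_hyp (2 * m) (z / (z - 1)) * (1 - z) ^ m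
      = (\<Sum>k\<le>m. pascal_coeff m k * (- 1) ^ k * z ^ k * (1 - z) ^ (m - k))"
    unfolding pascal_hyp_eq sum_distrib_right by (intro sum.cong refl) auto
  thus ?thesis by (simp add: pascal_U_def pfaff_coeff_sum mult.assoc)
qed

definition pascal_poly :: "nat \<Rightarrow> rat poly" where
  "pascal_poly m = (\<Sum>k\<le>m. monom (pascal_coeff m k) k)"

definition pfaff_poly :: "nat \<Rightarrow> rat poly" where
  "pfaff_poly m = (\<Sum>k\<le>m. monom (pfaff_coeff m k) k)"

lemma coeff_pascal_poly: "coeff (pascal_poly m) k = pascal_coeff m k"
  by (simp add: pascal_poly_def coeff_sum pascal_coeff_eq_0)

lemma coeff_pfaff_poly: "coeff (pfaff_poly m) k = pfaff_coeff m k"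
  by (simp add: pfaff_poly_def coeff_sum pfaff_coeff_eq_0)

lemma poly_pascal_poly: "poly (pascal_poly m) x = (\<Sum>k\<le>m. pascal_coeff m k * x ^ k)"
  by (simp add: pascal_poly_def poly_sum poly_monom)

lemma poly_pascal_poly_rev:
  "poly (pascal_poly m) x = (\<Sum>k\<le>m. pascal_coeff m k * x ^ (m - k))"
  unfolding poly_pascal_poly
  by (rule sum.reindex_bij_witness[of _ "\<lambda>k. m - k" "\<lambda>k. m - k"])
     (auto simp: pascal_coeff_palindromic)

lemma poly_pfaff_poly:
  "poly (pfaff_poly m) x = (\<Sum>j\<le>m. pascal_coeff m j * (- 1) ^ j * x ^ j * (1 - x) ^ (m - j))"
  unfolding pfaff_coeff_sum[symmetric] by (simp add: pfaff_poly_def poly_sum poly_monom)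

lemma degree_pascal_poly: "degree (pascal_poly m) \<le> m"
  by (rule degree_le) (simp add: coeff_pascal_poly pascal_coeff_eq_0)

lemma degree_pfaff_poly: "degree (pfaff_poly m) \<le> m"
  by (rule degree_le) (simp add: coeff_pfaff_poly pfaff_coeff_eq_0)

text \<open>
  Replacing \<open>x\<close> by \<open>1 - x\<close> exchanges \<open>x ^ j\<close> and \<open>(1 - x) ^ (m - j)\<close> up to reversing \<open>j\<close>, and the
  coefficients are palindromic.
\<close>
lemma pfaff_poly_reflect: "pfaff_poly m \<circ>\<^sub>p [:1, - 1:] = smult ((- 1) ^ m) (pfaff_poly m)"
proof -
  have "poly (pfaff_poly m) (1 - x) = (- 1) ^ m * poly (pfaff_poly m) x" for x
    unfolding poly_pfaff_poly sum_distrib_left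
  proof (rule sum.reindex_bij_witness[of _ "\<lambda>k. m - k" "\<lambda>k. m - k"], goal_cases)
    case (5 j)
    hence "(- 1) ^ m * (- 1) ^ (m - j) = ((- 1) ^ j :: rat)"
      by (auto simp: minus_one_power_iff)
    thus ?case using 5 by (simp add: pascal_coeff_palindromic mult_ac)
  qed auto
  hence "poly (pfaff_poly m \<circ>\<^sub>p [:1, - 1:]) = poly (smult ((- 1) ^ m) (pfaff_poly m))"
    by (intro ext) (simp add: poly_pcompose)
  thus ?thesis by (simp only: poly_eq_poly_eq_iff)
qed

lemma pfaff_poly_reciprocal:
  assumes "x \<noteq> 0"
  shows "x ^ m * poly (pfaff_poly m) (inverse x) = (- 1) ^ m * poly (pascal_poly m) (1 - x)"
  unfolding poly_pfaff_poly poly_pascal_poly_rev sum_distrib_left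
proof (intro sum.cong refl)
  fix j assume "j \<in> {..m}"
  hence j: "m = j + (m - j)" by simp
  have "x ^ m * (inverse x ^ j * (1 - inverse x) ^ (m - j)) 
      = (x * inverse x) ^ j * (x * (1 - inverse x)) ^ (m - j)"
    unfolding power_mult_distrib by (subst j, subst power_add) (simp add: mult_ac)
  also have "\<dots> = (- 1) ^ (m - j) * (1 - x) ^ (m - j)"
    using assms by (simp add: right_diff_distrib flip: power_mult_distrib)
  finally have "x ^ m * (inverse x ^ j * (1 - inverse x) ^ (m - j)) = \<dots>" .
  moreover have "(- 1) ^ m = (- 1) ^ j * ((- 1) ^ (m - j) :: rat)"
    using j by (simp flip: power_add)
  ultimately show "x ^ m * (pascal_coeff m j * (- 1) ^ j * inverse x ^ j * (1 - inverse x) ^ (m - j))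
      = (- 1) ^ m * (pascal_coeff m j * (1 - x) ^ (m - j))"
    by (simp add: mult_ac)
qed

lemma pascal_poly_reciprocal:
  assumes "x \<noteq> 0"
  shows "x ^ m * poly (pascal_poly m) (inverse x) = poly (pascal_poly m) x"
proof (subst poly_pascal_poly, subst poly_pascal_poly_rev, unfold sum_distrib_left, intro sum.cong refl)
  fix k assume "k \<in> {..m}"
  thus "x ^ m * (pascal_coeff m k * inverse x ^ k) = pascal_coeff m k * x ^ (m - k)"
    using assms by (simp add: power_diff power_inverse field_simps)
qed

section \<open>The fixed vector\<close>

definition neg_binomial_fps :: "nat \<Rightarrow> rat fps" where
  "neg_binomial_fps n = inverse ((1 - fps_X) ^ n)"

lemma neg_binomial_fps_nth: "fps_nth (neg_binomial_fps (Suc k)) j = of_nat ((j + k) choose j)"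
  using one_minus_const_fps_X_neg_power'[of "Suc k" "1 :: rat"]
  by (simp add: neg_binomial_fps_def add.commute)

lemma neg_binomial_fps_mult_power:
  assumes "l \<le> n"
  shows "neg_binomial_fps n * (1 - fps_X) ^ l = neg_binomial_fps (n - l)"
proof -
  have u: "fps_nth ((1 - fps_X) ^ l :: rat fps) 0 \<noteq> 0" by (simp add: fps_nth_power_0)
  have "(1 - fps_X :: rat fps) ^ n = (1 - fps_X) ^ (n - l) * (1 - fps_X) ^ l"
    using assms by (simp flip: power_add)
  thus ?thesis
    by (simp only: neg_binomial_fps_def fps_inverse_mult mult.assoc inverse_mult_eq_1[OF u] mult_1_right)
qed

lemma fps_of_poly_one_minus: "fps_of_poly [:1, - 1:] = (1 - fps_X :: rat fps)"
  by (simp add: fps_eq_iff coeff_pCons split: nat.split)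

lemma fps_pfaff_poly:
  "fps_of_poly (pfaff_poly m)
   = (\<Sum>j\<le>m. fps_const (pascal_coeff m j * (- 1) ^ j) * fps_X ^ j * (1 - fps_X) ^ (m - j))"
proof -
  have "poly (pfaff_poly m)
      = poly (\<Sum>j\<le>m. [:pascal_coeff m j * (- 1) ^ j:] * [:0, 1:] ^ j * [:1, - 1:] ^ (m - j))"
    by (intro ext) (simp add: poly_pfaff_poly poly_sum mult.assoc)
  hence "pfaff_poly m
      = (\<Sum>j\<le>m. [:pascal_coeff m j * (- 1) ^ j:] * [:0, 1:] ^ j * [:1, - 1:] ^ (m - j))"
    by (simp only: poly_eq_poly_eq_iff)
  thus ?thesis
    by (simp only: fps_of_poly_sum fps_of_poly_mult fps_of_poly_power fps_of_poly_const
        fps_of_poly_fps_X fps_of_poly_one_minus)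
qed

text \<open>
  Euler's transformation ${}_2F_1(a, b; c; x) = (1-x)^{c-a-b} {}_2F_1(c-a, c-b; c; x)$ for \<open>c = - 2 m\<close>
  holds only modulo \<open>X ^ (2 * m + 1)\<close>. It is the composite of the two Pfaff transformations: the first
  is built into \<open>fps_pfaff_poly\<close>, the second maps the parameters to themselves because
  \<open>c - a = - 2 m + m = a\<close>.
\<close>
lemma euler_transformation:
  assumes "i \<le> 2 * m"
  shows "fps_nth (neg_binomial_fps (2 * m + 1) * fps_of_poly (pfaff_poly m)) i = pascal_coeff m i"
proof -
  define F where "F j = fps_X ^ j * neg_binomial_fps (Suc (m + j))" for j
  have F: "fps_nth (F j) i = (if j \<le> i then of_nat ((m + i) choose (i - j)) else 0)" for j
    unfolding F_def by (simp add: fps_X_power_mult_nth neg_binomial_fps_nth add.commute)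
  have "neg_binomial_fps (2 * m + 1) * fps_of_poly (pfaff_poly m)
      = (\<Sum>j\<le>m. fps_const (pascal_coeff m j * (- 1) ^ j) * fps_X ^ j
           * (neg_binomial_fps (2 * m + 1) * (1 - fps_X) ^ (m - j)))"
    unfolding fps_pfaff_poly sum_distrib_left by (intro sum.cong refl) (simp only: mult_ac)
  also have "\<dots> = (\<Sum>j\<le>m. fps_const (pascal_coeff m j * (- 1) ^ j) * F j)"
    unfolding F_def mult.assoc
    by (intro sum.cong refl) (simp add: neg_binomial_fps_mult_power)
  finally have "fps_nth (neg_binomial_fps (2 * m + 1) * fps_of_poly (pfaff_poly m)) i
      = (\<Sum>j\<le>m. pascal_coeff m j * (- 1) ^ j * fps_nth (F j) i)"
    by (simp add: fps_sum_nth)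
  also have "\<dots> = (\<Sum>j\<le>m + i. pascal_coeff m j * (- 1) ^ j * fps_nth (F j) i)"
    by (intro sum.mono_neutral_left) (auto simp: pascal_coeff_eq_0)
  also have "\<dots> = (\<Sum>j\<le>i. pascal_coeff m j * (- 1) ^ j * fps_nth (F j) i)"
    by (intro sum.mono_neutral_right) (auto simp: F)
  also have "\<dots> = (\<Sum>j\<le>i. pascal_coeff m j * (- 1) ^ j
      * (pochhammer (of_nat m + 1 + of_nat j) (i - j) / fact (i - j)))"
  proof (intro sum.cong refl)
    fix j assume "j \<in> {..i}"
    hence j: "j \<le> i" by simp
    have "pochhammer (of_nat m + 1 + of_nat j :: rat) (i - j)
        = pochhammer (of_nat (m + j) + 1) (i - j)" by (simp add: add_ac)
    also have "\<dots> / fact (i - j) = of_nat ((m + i) choose (i - j))"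
      unfolding pochhammer_of_nat_plus_1 using j by (simp add: binomial_fact add_ac)
    finally show "pascal_coeff m j * (- 1) ^ j * fps_nth (F j) i = pascal_coeff m j * (- 1) ^ j
      * (pochhammer (of_nat m + 1 + of_nat j) (i - j) / fact (i - j))"
      using j by (simp add: F)
  qed
  also have "\<dots> = hyp_coeff (- of_nat (2 * m) - - of_nat m) (of_nat m + 1) (- of_nat (2 * m)) i"
    unfolding pascal_coeff_def by (rule pfaff_coefficients, rule pochhammer_neg_nonzero, rule assms)
  also have "- of_nat (2 * m) - - of_nat m = (- of_nat m :: rat)" by simp
  finally show ?thesis unfolding pascal_coeff_def .
qed

text \<open>
  The statement lists the generating function from the top entry downwards, hence the reversal.
\<close>
definition eigen_coeff :: "nat \<Rightarrow> nat \<Rightarrow> rat" where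
  "eigen_coeff m k = coeff (pascal_poly m * pfaff_poly m) (2 * m - k)"

lemma degree_eigen: "degree (pascal_poly m * pfaff_poly m) \<le> 2 * m"
  using degree_mult_le[of "pascal_poly m" "pfaff_poly m"] degree_pascal_poly[of m]
    degree_pfaff_poly[of m] by simp

lemma sum_eigen_coeff:
  "(\<Sum>k\<le>2 * m. f k * eigen_coeff m k)
     = (\<Sum>i\<le>2 * m. f (2 * m - i) * coeff (pascal_poly m * pfaff_poly m) i)"
  unfolding eigen_coeff_def
  by (rule sum.reindex_bij_witness[of _ "\<lambda>k. 2 * m - k" "\<lambda>k. 2 * m - k"]) auto

lemma poly_as_sum_le:
  fixes p :: "rat poly"
  assumes "degree p \<le> n" shows "poly p x = (\<Sum>i\<le>n. coeff p i * x ^ i)"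
proof -
  have "(\<Sum>i\<le>degree p. coeff p i * x ^ i) = (\<Sum>i\<le>n. coeff p i * x ^ i)"
    using assms by (intro sum.mono_neutral_left) (auto simp: coeff_eq_0)
  thus ?thesis by (simp add: poly_altdef)
qed

text \<open>
  Reversal is the substitution of \<open>1 / x\<close>. It fixes the palindromic first factor and turns the second
  one into the reflection of the first.
\<close>
lemma eigen_coeff_poly:
  "(\<Sum>k\<le>2 * m. monom (eigen_coeff m k) k)
     = smult ((- 1) ^ m) (pascal_poly m * (pascal_poly m \<circ>\<^sub>p [:1, - 1:]))" (is "?V = ?R")
proof -
  let ?W = "pascal_poly m * pfaff_poly m"
  have "poly ?V x = poly ?R x" if x: "x \<noteq> 0" for x
  proof -
    have "poly ?V x = (\<Sum>k\<le>2 * m. x ^ k * eigen_coeff m k)"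
      by (simp add: poly_sum poly_monom mult.commute)
    also have "\<dots> = x ^ (2 * m) * (\<Sum>i\<le>2 * m. coeff ?W i * inverse x ^ i)"
      unfolding sum_eigen_coeff sum_distrib_left using x
      by (intro sum.cong refl) (simp add: power_diff power_inverse field_simps)
    also have "\<dots> = x ^ (2 * m) * poly ?W (inverse x)"
      by (simp only: poly_as_sum_le[OF degree_eigen])
    also have "\<dots> = (x ^ m * poly (pascal_poly m) (inverse x)) * (x ^ m * poly (pfaff_poly m) (inverse x))"
      by (simp add: mult_2 power_add)
    also have "\<dots> = poly ?R x"
      using x by (simp add: pascal_poly_reciprocal pfaff_poly_reciprocal poly_pcompose)
    finally show ?thesis .
  qed
  \<comment> \<open>The substitution excludes \<open>x = 0\<close>; multiplying by the variable covers it.\<close>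
  hence "x * poly ?V x = x * poly ?R x" for x by (cases "x = 0") simp_all
  moreover have "poly ([:0, 1:] * p) x = x * poly p x" for p :: "rat poly" and x by simp
  ultimately have "poly ([:0, 1:] * ?V) = poly ([:0, 1:] * ?R)" by (simp only: fun_eq_iff) blast
  hence "[:0, 1:] * ?V = [:0, 1:] * ?R" by (simp only: poly_eq_poly_eq_iff)
  thus ?thesis unfolding mult_cancel_left by simp
qed

text \<open>
  The image of the vector is read off from \<open>(1 - X) ^ (- 2 m - 1)\<close> times \<open>W(1 - X)\<close>. Of the two factors
  of \<open>W(1 - X)\<close>, the second is the original one up to sign and absorbs the negative power by Euler's
  transformation.
\<close>
lemma eigen_coeff_fixed:
  assumes "j \<le> 2 * m"
  shows "(\<Sum>k\<le>2 * m. of_nat ((j + k) choose j) * eigen_coeff m k) = eigen_coeff m j"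
proof -
  let ?W = "pascal_poly m * pfaff_poly m" and ?N = "neg_binomial_fps (2 * m + 1)"
    and ?H = "fps_of_poly (pascal_poly m \<circ>\<^sub>p [:1, - 1:])" and ?K = "fps_of_poly (pfaff_poly m)"
  have "(\<Sum>k\<le>2 * m. of_nat ((j + k) choose j) * eigen_coeff m k)
      = fps_nth (\<Sum>i\<le>2 * m. neg_binomial_fps (Suc (2 * m - i)) * fps_const (coeff ?W i)) j"
    unfolding sum_eigen_coeff by (simp add: fps_sum_nth neg_binomial_fps_nth)
  also have "(\<Sum>i\<le>2 * m. neg_binomial_fps (Suc (2 * m - i)) * fps_const (coeff ?W i))
      = ?N * (\<Sum>i\<le>2 * m. fps_const (coeff ?W i) * (1 - fps_X) ^ i)"
    unfolding sum_distrib_left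
    by (intro sum.cong refl)
       (simp add: Suc_diff_le neg_binomial_fps_mult_power mult.left_commute[of "neg_binomial_fps _"])
  also have "(\<Sum>i\<le>2 * m. fps_const (coeff ?W i) * (1 - fps_X) ^ i)
      = fps_of_poly (?W \<circ>\<^sub>p [:1, - 1:])"
  proof -
    have "poly (?W \<circ>\<^sub>p [:1, - 1:]) = poly (\<Sum>i\<le>2 * m. [:coeff ?W i:] * [:1, - 1:] ^ i)"
      using poly_as_sum_le[OF degree_eigen[of m]]
      by (intro ext) (simp add: poly_pcompose poly_sum del: poly_mult)
    hence "?W \<circ>\<^sub>p [:1, - 1:] = (\<Sum>i\<le>2 * m. [:coeff ?W i:] * [:1, - 1:] ^ i)"
      by (simp only: poly_eq_poly_eq_iff)
    thus ?thesis
      by (simp only: fps_of_poly_sum fps_of_poly_mult fps_of_poly_power fps_of_poly_const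
        fps_of_poly_one_minus)
  qed
  also have "?N * \<dots> = fps_const ((- 1) ^ m) * (?H * (?N * ?K))"
    by (simp only: pcompose_mult pfaff_poly_reflect fps_of_poly_mult fps_of_poly_smult mult_ac)
  also have "fps_nth \<dots> j = (- 1) ^ m * (\<Sum>i=0..j. fps_nth ?H i * fps_nth (?N * ?K) (j - i))"
    by (simp only: fps_mult_left_const_nth fps_mult_nth[of ?H])
  also have "(\<Sum>i=0..j. fps_nth ?H i * fps_nth (?N * ?K) (j - i))
      = (\<Sum>i=0..j. fps_nth ?H i * fps_nth (fps_of_poly (pascal_poly m)) (j - i))"
  proof (intro sum.cong refl)
    fix i assume "i \<in> {0..j}"
    hence "fps_nth (?N * ?K) (j - i) = pascal_coeff m (j - i)"
      using assms by (intro euler_transformation) auto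
    thus "fps_nth ?H i * fps_nth (?N * ?K) (j - i) = fps_nth ?H i * fps_nth (fps_of_poly (pascal_poly m)) (j - i)"
      by (simp only: fps_of_poly_nth coeff_pascal_poly)
  qed
  also have "(- 1) ^ m * \<dots> = coeff (smult ((- 1) ^ m) (pascal_poly m * (pascal_poly m \<circ>\<^sub>p [:1, - 1:]))) j"
    by (simp only: coeff_smult mult.commute[of "pascal_poly m"] coeff_mult fps_of_poly_nth
        atLeast0AtMost)
  also have "\<dots> = eigen_coeff m j"
    using assms by (simp only: flip: eigen_coeff_poly) (simp add: coeff_sum)
  finally show ?thesis .
qed


section \<open>The absolute value on the p-adic numbers\<close>

lemma padic_norm_0 [simp]: "padic_norm (0 :: 'p::prime_card padic) = 0"
  by (simp only: padic_norm_eq_0_iff)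

lemma padic_norm_1 [simp]: "padic_norm (1 :: 'p::prime_card padic) = 1"
  using padic_norm_of_rat[of 1, where ?'p = 'p] by (simp add: padic_abs_1[OF prime_card])

lemma padic_norm_power: "padic_norm (x ^ k) = padic_norm (x :: 'p::prime_card padic) ^ k"
  by (induction k) (simp_all add: padic_norm_mult)

lemma padic_norm_inverse: "padic_norm (inverse x) = inverse (padic_norm (x :: 'p::prime_card padic))"
proof (cases "x = 0")
  case False
  hence "padic_norm x * padic_norm (inverse x) = 1" by (simp flip: padic_norm_mult)
  thus ?thesis by (rule inverse_unique[symmetric])
qed simp

lemma padic_norm_divide: "padic_norm (x / y) = padic_norm x / padic_norm (y :: 'p::prime_card padic)"
  by (simp add: divide_inverse padic_norm_mult padic_norm_inverse)

lemma padic_norm_add_le_bound: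
  "padic_norm x \<le> e \<Longrightarrow> padic_norm y \<le> e \<Longrightarrow> padic_norm (x + y :: 'p::prime_card padic) \<le> e"
  using padic_norm_add_le[of x y] by linarith

lemma padic_norm_diff_le_bound:
  "padic_norm x \<le> e \<Longrightarrow> padic_norm y \<le> e \<Longrightarrow> padic_norm (x - y :: 'p::prime_card padic) \<le> e"
  using padic_norm_add_le_bound[of x e "- y"] by simp

lemma padic_norm_sum_le:
  fixes f :: "'i \<Rightarrow> 'p::prime_card padic"
  assumes "0 \<le> e" "\<And>i. i \<in> A \<Longrightarrow> padic_norm (f i) \<le> e"
  shows "padic_norm (sum f A) \<le> e"
  using assms(2)
  by (induction A rule: infinite_finite_induct) (auto simp: assms(1) intro: padic_norm_add_le_bound)

lemma padic_norm_of_nat: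
  assumes "i > 0"
  shows "padic_norm (of_nat i :: 'p::prime_card padic)
    = 1 / real CARD('p) ^ multiplicity (int CARD('p)) (int i)"
proof -
  have "padic_norm (of_nat i :: 'p padic) = padic_abs CARD('p) (of_nat i)"
    by (simp flip: padic_norm_of_rat)
  also have "\<dots> = padic_abs CARD('p) (of_int (int i) / of_int 1)" by simp
  also have "\<dots> = 1 / real CARD('p) ^ multiplicity (int CARD('p)) (int i)"
    by (subst padic_abs_of_int_divide[OF prime_card])
       (use assms in \<open>simp_all add: power_int_minus inverse_eq_divide\<close>)
  finally show ?thesis .
qed

lemma padic_norm_of_nat_le_1: "padic_norm (of_nat i :: 'p::prime_card padic) \<le> 1"
proof (cases "i = 0")
  case False
  thus ?thesis using prime_ge_1_nat[OF prime_card[where ?'a = 'p]]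
    by (simp add: padic_norm_of_nat)
qed simp

text \<open>
  The power of \<open>p\<close> dividing \<open>i\<close> is at most \<open>i\<close>. This crude bound replaces the valuation in all later
  estimates of denominators.
\<close>
lemma padic_norm_of_nat_ge:
  assumes "i > 0"
  shows "1 / real i \<le> padic_norm (of_nat i :: 'p::prime_card padic)"
proof -
  have "int CARD('p) ^ multiplicity (int CARD('p)) (int i) \<le> int i"
    using assms by (intro zdvd_imp_le multiplicity_dvd) auto
  hence "real CARD('p) ^ multiplicity (int CARD('p)) (int i) \<le> real i"
    by (metis of_int_le_iff of_int_of_nat_eq of_int_power)
  thus ?thesis using prime_gt_0_nat[OF prime_card[where ?'a = 'p]] assms
    unfolding padic_norm_of_nat[OF assms] by (intro divide_left_mono) auto
qed

lemma padic_norm_card: "padic_norm (of_nat CARD('p) :: 'p::prime_card padic) = 1 / real CARD('p)"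
  using prime_gt_0_nat[OF prime_card[where ?'a = 'p]] prime_card[where ?'a = 'p]
  by (simp add: padic_norm_of_nat)

lemma padic_norm_2:
  assumes "odd CARD('p::prime_card)"
  shows "padic_norm (2 :: 'p padic) = 1"
proof -
  have "\<not> int CARD('p) dvd 2"
  proof
    assume "int CARD('p) dvd 2"
    hence "CARD('p) dvd 2" by (metis int_dvd_int_iff of_nat_numeral)
    hence "CARD('p) \<le> 2" by (rule dvd_imp_le) simp
    hence "CARD('p) = 2" using prime_ge_2_nat[OF prime_card[where ?'a = 'p]] by simp
    thus False using assms by simp
  qed
  thus ?thesis using padic_norm_of_nat[of 2, where ?'p = 'p]
    by (simp add: not_dvd_imp_multiplicity_0)
qed

text \<open>
  Every nonzero \<open>z\<close> has the absolute value of a rational number close to it, which is an integral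
  power of \<open>p\<close>.
\<close>
lemma padic_norm_discrete:
  fixes z :: "'p::prime_card padic"
  assumes "padic_norm z < 1"
  shows "padic_norm z \<le> 1 / real CARD('p)"
proof (cases "z = 0")
  case False
  let ?p = "CARD('p)"
  have p: "real ?p > 1" using prime_gt_1_nat[OF prime_card[where ?'a = 'p]] by simp
  have "padic_norm z > 0" using False by (simp add: less_le)
  then obtain q where q: "padic_norm (z - of_rat q) < padic_norm z"
    using of_rat_dense_padic by blast
  have "padic_norm z \<le> padic_norm (of_rat q :: 'p padic)"
    using padic_norm_add_le[of "z - of_rat q" "of_rat q"] q by simp
  moreover have "padic_norm (of_rat q :: 'p padic) \<le> padic_norm z"
    using padic_norm_add_le_bound[of "of_rat q - z" "padic_norm z" z] q
    by (simp add: padic_norm_minus_commute)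
  ultimately have z: "padic_norm z = padic_abs ?p q"
    by (simp add: padic_norm_of_rat)
  hence "q \<noteq> 0" using \<open>padic_norm z > 0\<close> by (auto simp: padic_abs_def)
  then obtain e where e: "padic_norm z = real ?p powi e"
    using z by (auto simp: padic_abs_def)
  have "e \<le> - 1"
  proof (rule ccontr)
    assume "\<not> e \<le> - 1"
    hence "1 \<le> real ?p powi e" using p by (intro one_le_power_int) auto
    thus False using assms e by simp
  qed
  hence "real ?p powi e \<le> real ?p powi (- 1)" using p by (intro power_int_increasing) auto
  thus ?thesis by (simp add: e power_int_minus inverse_eq_divide)
qed simp

lemma padic_congI:
  fixes a b :: "'p::prime_card padic"
  assumes "padic_norm (a - b) \<le> 1 / real CARD('p) ^ n"
  shows "padic_cong a b n"
  unfolding padic_cong_def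
proof
  have p: "CARD('p) > 0" by (rule prime_gt_0_nat[OF prime_card])
  thus "a - b = of_nat CARD('p) ^ n * ((a - b) / of_nat CARD('p) ^ n)" by simp
  show "(a - b) / of_nat CARD('p) ^ n \<in> padic_integers"
    using assms p
    by (simp add: padic_integers_def padic_norm_divide padic_norm_power padic_norm_card field_simps)
qed

lemma padic_norm_prod_minus_1_le:
  fixes f :: "'i \<Rightarrow> 'p::prime_card padic"
  assumes "0 \<le> e" "e \<le> 1" "\<And>i. i \<in> A \<Longrightarrow> padic_norm (f i - 1) \<le> e"
  shows "padic_norm (prod f A - 1) \<le> e"
  using assms(3)
proof (induction A rule: infinite_finite_induct)
  case (insert i A)
  have *: "padic_norm (prod f A - 1) \<le> e" using insert by auto
  have "padic_norm (prod f A) \<le> 1"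
    using padic_norm_add_le_bound[of "prod f A - 1" 1 1] * assms(2) by simp
  hence "padic_norm ((f i - 1) * prod f A) \<le> e * 1"
    unfolding padic_norm_mult using insert.prems assms by (intro mult_mono) auto
  hence "padic_norm ((f i - 1) * prod f A + (prod f A - 1)) \<le> e"
    using * by (intro padic_norm_add_le_bound) auto
  moreover have "prod f (insert i A) - 1 = (f i - 1) * prod f A + (prod f A - 1)"
    using insert.hyps by (simp add: algebra_simps)
  ultimately show ?case by (simp only:)
qed (use assms in auto)

lemma padic_norm_mult_minus_1_le:
  fixes x y :: "'p::prime_card padic"
  assumes "e \<le> 1" "padic_norm (x - 1) \<le> e" "padic_norm (y - 1) \<le> e"
  shows "padic_norm (x * y - 1) \<le> e"
  using padic_norm_prod_minus_1_le[of e "UNIV :: bool set" "\<lambda>b. if b then x else y"] assms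
    order.trans[OF padic_norm_nonneg assms(2)] by (simp add: UNIV_bool mult.commute)

lemma padic_norm_inverse_minus_1:
  fixes x :: "'p::prime_card padic"
  assumes "padic_norm (x - 1) < 1"
  shows "padic_norm (inverse x - 1) = padic_norm (x - 1)"
proof -
  have "padic_norm x = 1"
  proof (rule antisym)
    show "padic_norm x \<le> 1" using padic_norm_add_le_bound[of "x - 1" 1 1] assms by simp
    show "1 \<le> padic_norm x" using padic_norm_add_le[of x "1 - x"] assms
      by (simp add: padic_norm_minus_commute)
  qed
  moreover from this have "inverse x - 1 = (1 - x) / x" by (cases "x = 0") (auto simp: field_simps)
  ultimately show ?thesis by (simp add: padic_norm_divide padic_norm_minus_commute)
qed

section \<open>Congruence with the limiting series\<close>

definition half_coeff :: "nat \<Rightarrow> 'a::field_char_0" where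
  "half_coeff = hyp_coeff (1 / 2) (1 / 2) 1"

lemma half_coeff_binomial: "half_coeff j = (of_nat ((2 * j) choose j))\<^sup>2 / (16 ^ j :: 'a::field_char_0)"
proof -
  have "2 * j - j = j" by simp
  hence "of_nat ((2 * j) choose j) = (4 ^ j * pochhammer (1 / 2) j / fact j :: 'a)"
    by (simp add: binomial_fact fact_double power_mult)
  moreover have "(16 :: 'a) ^ j = 4 ^ j * 4 ^ j" by (simp flip: power_mult_distrib)
  ultimately show ?thesis
    by (simp add: half_coeff_def hyp_coeff_def power2_eq_square flip: pochhammer_fact)
qed

lemma padic_norm_half_coeff_le_1:
  assumes "odd CARD('p::prime_card)"
  shows "padic_norm (half_coeff j :: 'p padic) \<le> 1"
proof -
  have "padic_norm (16 :: 'p padic) = padic_norm (2 ^ 4 :: 'p padic)" by simp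
  hence "padic_norm (16 :: 'p padic) = 1"
    by (simp only: padic_norm_power padic_norm_2[OF assms] power_one)
  thus ?thesis
    by (simp add: half_coeff_binomial padic_norm_divide padic_norm_power padic_norm_of_nat_le_1 power_le_one)
qed

text \<open>
  Each factor \<open>(1 + s) / 2 + i\<close> of a rising factorial is the unperturbed factor \<open>(2 i + 1) / 2\<close> times
  \<open>1 + s / (2 i + 1)\<close>, and likewise for \<open>1 - q + i\<close>.
\<close>
lemma hyp_coeff_perturbed:
  fixes q t :: "'a::field_char_0"
  shows "hyp_coeff ((1 - q) / 2) ((1 + t * q) / 2) (1 - q) j
    = half_coeff j * (\<Prod>i<j. (1 - q / of_nat (2 * i + 1)) * (1 + t * q / of_nat (2 * i + 1))
        * inverse (1 - q / of_nat (i + 1)))"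
proof -
  have half: "pochhammer ((1 + s) / 2) j = pochhammer (1 / 2) j * (\<Prod>i<j. 1 + s / of_nat (2 * i + 1))"
    for s :: 'a
    unfolding pochhammer_prod atLeast0LessThan prod.distrib[symmetric]
  proof (intro prod.cong refl)
    fix i
    define d :: 'a where "d = of_nat (2 * i + 1)"
    have "d \<noteq> 0" unfolding d_def by (simp only: of_nat_eq_0_iff)
    hence "(d + s) / 2 = d / 2 * (1 + s / d)" by (simp add: field_simps)
    moreover have "(1 + s) / 2 + of_nat i = (d + s) / 2" "1 / 2 + of_nat i = d / 2"
      by (simp_all add: d_def field_simps)
    ultimately show "(1 + s) / 2 + of_nat i = (1 / 2 + of_nat i) * (1 + s / of_nat (2 * i + 1))"
      by (simp only: d_def)
  qed
  have c: "pochhammer (1 - q) j = pochhammer 1 j * (\<Prod>i<j. 1 - q / of_nat (i + 1))"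
    unfolding pochhammer_prod atLeast0LessThan prod.distrib[symmetric]
  proof (intro prod.cong refl)
    fix i
    have "of_nat (i + 1) \<noteq> (0 :: 'a)" by (simp only: of_nat_eq_0_iff)
    thus "1 - q + of_nat i = (1 + of_nat i) * (1 - q / of_nat (i + 1))"
      by (simp add: right_diff_distrib)
  qed
  have a: "pochhammer ((1 - q) / 2) j = pochhammer (1 / 2) j * (\<Prod>i<j. 1 - q / of_nat (2 * i + 1))"
    using half[of "- q"] by simp
  have inv: "(\<Prod>i<j. inverse (f i)) = inverse (\<Prod>i<j. f i)" for f :: "nat \<Rightarrow> 'a"
    by (induction j) simp_all
  show ?thesis
    unfolding hyp_coeff_def half_coeff_def a half c prod.distrib inv
    by (simp only: divide_inverse inverse_mult_distrib mult_ac)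
qed

lemma double_le_power3: "2 * j \<le> (3 :: nat) ^ j"
proof (induction j)
  case (Suc j)
  moreover have "(1 :: nat) \<le> 3 ^ j" by simp
  ultimately show ?case unfolding power_Suc mult_Suc_right by linarith
qed simp

lemma padic_norm_power_div_le:
  assumes "0 < i" "i \<le> l"
  shows "padic_norm (of_nat (CARD('p) ^ n) / of_nat i :: 'p::prime_card padic)
    \<le> real l / real CARD('p) ^ n"
proof -
  have p: "CARD('p) > 0" by (rule prime_gt_0_nat[OF prime_card])
  have "0 < 1 / real i" using assms by simp
  also have "\<dots> \<le> padic_norm (of_nat i :: 'p padic)" using assms by (intro padic_norm_of_nat_ge)
  finally have "0 < padic_norm (of_nat i :: 'p padic)" .
  hence "1 / padic_norm (of_nat i :: 'p padic) \<le> 1 / (1 / real i)"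
    using padic_norm_of_nat_ge[OF assms(1), where ?'p = 'p] assms
    by (intro divide_left_mono mult_pos_pos) auto
  also have "\<dots> \<le> real l" using assms by simp
  finally have "1 / padic_norm (of_nat i :: 'p padic) * (1 / real CARD('p) ^ n)
      \<le> real l * (1 / real CARD('p) ^ n)" by (intro mult_right_mono) auto
  thus ?thesis
    by (simp add: padic_norm_divide padic_norm_power padic_norm_card power_one_over field_simps)
qed

text \<open>
  All denominators \<open>i\<close> in \<open>hyp_coeff_perturbed\<close> satisfy \<open>i \<le> 2 j \<le> p ^ j\<close>, so the factors differ from
  \<open>1\<close> by at most \<open>p ^ j / p ^ n\<close>; the hypothesis \<open>2 j < p ^ n\<close> makes the factors to be inverted units.
\<close>
lemma hyp_coeff_congruence:
  fixes t :: "'p::prime_card padic"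
  assumes odd: "odd CARD('p)" and q: "q = of_nat (CARD('p) ^ n)" and t: "padic_norm t \<le> 1"
    and j: "2 * j < CARD('p) ^ n"
  shows "padic_norm (hyp_coeff ((1 - q) / 2) ((1 + t * q) / 2) (1 - q) j - half_coeff j)
    \<le> real CARD('p) ^ j / real CARD('p) ^ n"
proof -
  let ?p = "real CARD('p)"
  have p: "CARD('p) \<ge> 3" using prime_ge_2_nat[OF prime_card[where ?'a = 'p]] odd
    by (cases "CARD('p) = 2") auto
  define e where "e = min 1 (?p ^ j / ?p ^ n)"
  have e: "0 \<le> e" "e \<le> 1" "e \<le> ?p ^ j / ?p ^ n" by (auto simp: e_def)
  have "2 * j \<le> CARD('p) ^ j" 
    using double_le_power3[of j] power_mono[OF p, of j] by linarith
  hence j': "2 * real j \<le> ?p ^ j" by (metis of_nat_le_iff of_nat_mult of_nat_numeral of_nat_power)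
  have jn: "2 * real j < ?p ^ n" using j by (metis of_nat_less_iff of_nat_mult of_nat_numeral of_nat_power)
  have small: "padic_norm (q / of_nat i) \<le> e \<and> padic_norm (q / of_nat i) < 1"
    if "0 < i" "i \<le> 2 * j" for i
  proof -
    have "padic_norm (q / of_nat i) \<le> real (2 * j) / ?p ^ n"
      unfolding q using that by (rule padic_norm_power_div_le)
    moreover have "real (2 * j) / ?p ^ n \<le> ?p ^ j / ?p ^ n"
      using j' by (intro divide_right_mono) auto
    moreover have "real (2 * j) / ?p ^ n < 1"
      using jn p by simp
    ultimately show ?thesis unfolding e_def by (intro conjI min.boundedI) linarith+
  qed
  have "padic_norm ((\<Prod>i<j. (1 - q / of_nat (2 * i + 1)) * (1 + t * q / of_nat (2 * i + 1))
        * inverse (1 - q / of_nat (i + 1))) - 1) \<le> e"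
  proof (intro padic_norm_prod_minus_1_le padic_norm_mult_minus_1_le e)
    fix i assume "i \<in> {..<j}"
    hence i: "2 * i + 1 \<le> 2 * j" "i + 1 \<le> 2 * j" by auto
    note s1 = small[OF _ i(1)] and s2 = small[OF _ i(2)]
    show "padic_norm (1 - q / of_nat (2 * i + 1) - 1) \<le> e" using s1 by simp
    have "padic_norm (t * (q / of_nat (2 * i + 1))) \<le> 1 * e"
      unfolding padic_norm_mult using s1 t by (intro mult_mono) auto
    thus "padic_norm (1 + t * q / of_nat (2 * i + 1) - 1) \<le> e" by simp
    show "padic_norm (inverse (1 - q / of_nat (i + 1)) - 1) \<le> e"
      using s2 by (subst padic_norm_inverse_minus_1) simp_all
  qed
  hence "padic_norm (half_coeff j * ((\<Prod>i<j. (1 - q / of_nat (2 * i + 1))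
      * (1 + t * q / of_nat (2 * i + 1)) * inverse (1 - q / of_nat (i + 1))) - 1)) \<le> 1 * e"
    unfolding padic_norm_mult using padic_norm_half_coeff_le_1[OF odd] by (intro mult_mono) auto
  thus ?thesis using e(3) unfolding hyp_coeff_perturbed by (simp add: right_diff_distrib)
qed

lemma half_series:
  fixes z :: "'p::prime_card padic"
  assumes odd: "odd CARD('p)" and z: "padic_norm z < 1"
  shows padic_norm_half_term: "padic_norm (half_coeff j * z ^ j) \<le> 1 / real CARD('p) ^ j"
    and half_series_sums: "(\<lambda>j. half_coeff j * z ^ j) sums hyp2F1 (1/2) (1/2) 1 z"
proof -
  let ?p = "real CARD('p)"
  have p: "?p > 1" using prime_gt_1_nat[OF prime_card[where ?'a = 'p]] by simp
  have le: "padic_norm (half_coeff j * z ^ j) \<le> 1 / ?p ^ j" for j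
  proof -
    have "padic_norm (half_coeff j * z ^ j) \<le> 1 * (1 / ?p) ^ j"
      unfolding padic_norm_mult padic_norm_power
      using padic_norm_half_coeff_le_1[OF odd] padic_norm_discrete[OF z]
      by (intro mult_mono power_mono) auto
    thus ?thesis by (simp add: power_one_over)
  qed
  thus "padic_norm (half_coeff j * z ^ j) \<le> 1 / ?p ^ j" .
  define S where "S k = (\<Sum>j<k. half_coeff j * z ^ j)" for k
  have S: "padic_norm (S k - S l) \<le> 1 / ?p ^ l" if "l \<le> k" for k l
  proof -
    have "S k - S l = (\<Sum>j=l..<k. half_coeff j * z ^ j)"
      unfolding S_def using that sum_diff_nat_ivl[of 0 l k "\<lambda>j. half_coeff j * z ^ j"]
      by (simp add: atLeast0LessThan)
    also have "padic_norm \<dots> \<le> 1 / ?p ^ l"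
    proof (rule padic_norm_sum_le)
      fix j assume "j \<in> {l..<k}"
      hence "1 / ?p ^ j \<le> 1 / ?p ^ l" using p by (intro divide_left_mono power_increasing) auto
      thus "padic_norm (half_coeff j * z ^ j) \<le> 1 / ?p ^ l" using le[of j] by simp
    qed simp
    finally show ?thesis .
  qed
  have "Cauchy S"
  proof (rule metric_CauchyI)
    fix e :: real assume "e > 0"
    then obtain l where l: "(1 / ?p) ^ l < e"
      using real_arch_pow_inv[of e "1 / ?p"] p by auto
    have "dist (S k) (S k') < e" if "k \<ge> l" "k' \<ge> l" for k k'
    proof -
      have "padic_norm ((S k - S l) - (S k' - S l)) \<le> 1 / ?p ^ l"
        using that by (intro padic_norm_diff_le_bound S) auto
      thus ?thesis using l by (simp add: dist_padic_def power_one_over)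
    qed
    thus "\<exists>l. \<forall>k\<ge>l. \<forall>k'\<ge>l. dist (S k) (S k') < e" by blast
  qed
  hence "convergent S" by (rule Cauchy_convergent)
  hence "summable (\<lambda>j. half_coeff j * z ^ j)"
    by (simp add: summable_def sums_def convergent_def S_def[abs_def])
  moreover have "hyp2F1 (1/2) (1/2) 1 z = (\<Sum>j. half_coeff j * z ^ j)"
    by (simp add: hyp2F1_def half_coeff_def hyp_coeff_def)
  ultimately show "(\<lambda>j. half_coeff j * z ^ j) sums hyp2F1 (1/2) (1/2) 1 z"
    by (simp add: summable_sums)
qed

lemma padic_norm_sums_diff_le:
  fixes f g :: "nat \<Rightarrow> 'p::prime_card padic"
  assumes "f sums s" "0 < e" "\<And>j. j \<le> m \<Longrightarrow> padic_norm (g j - f j) \<le> e"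
    "\<And>j. m < j \<Longrightarrow> padic_norm (f j) \<le> e"
  shows "padic_norm ((\<Sum>j\<le>m. g j) - s) \<le> e"
proof -
  obtain k0 where k0: "\<And>k. k \<ge> k0 \<Longrightarrow> dist (\<Sum>j<k. f j) s < e"
    using assms(1,2) unfolding sums_def LIMSEQ_def by blast
  define k where "k = max k0 (Suc m)"
  have "(\<Sum>j\<le>m. g j) = (\<Sum>j<k. if j \<le> m then g j else 0)"
    by (rule sum.mono_neutral_cong_left) (auto simp: k_def)
  hence "(\<Sum>j\<le>m. g j) - (\<Sum>j<k. f j) = (\<Sum>j<k. (if j \<le> m then g j else 0) - f j)"
    by (simp add: sum_subtractf)
  also have "padic_norm \<dots> \<le> e"
    by (rule padic_norm_sum_le) (use assms in auto)
  finally have "padic_norm ((\<Sum>j\<le>m. g j) - (\<Sum>j<k. f j)) \<le> e" .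
  moreover have "padic_norm ((\<Sum>j<k. f j) - s) \<le> e"
    using k0[of k] by (simp add: k_def dist_padic_def)
  ultimately show ?thesis using padic_norm_add_le_bound by fastforce
qed

text \<open>
  The terms up to \<open>m\<close> are compared one by one, the loss \<open>p ^ j\<close> of \<open>hyp_coeff_congruence\<close> being
  compensated by \<open>z ^ j\<close>. The terms beyond \<open>m\<close> are small by themselves, since \<open>j > m\<close> implies \<open>j \<ge> n\<close>.
\<close>
lemma hyp_poly_congruence:
  fixes t z :: "'p::prime_card padic"
  assumes odd: "odd CARD('p)" and q: "q = of_nat (CARD('p) ^ n)" and t: "padic_norm t \<le> 1"
    and m: "2 * m + 1 = CARD('p) ^ n" and z: "padic_norm z < 1"
  shows "padic_norm ((\<Sum>j\<le>m. hyp_coeff ((1 - q) / 2) ((1 + t * q) / 2) (1 - q) j * z ^ j)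
     - hyp2F1 (1/2) (1/2) 1 z) \<le> 1 / real CARD('p) ^ n"
proof (rule padic_norm_sums_diff_le[OF half_series_sums[OF odd z]])
  let ?p = "real CARD('p)"
  have p: "CARD('p) > 1" by (rule prime_gt_1_nat[OF prime_card])
  show "0 < 1 / ?p ^ n" using p by simp
  fix j
  {
    assume j: "j \<le> m"
    let ?c = "hyp_coeff ((1 - q) / 2) ((1 + t * q) / 2) (1 - q) j"
    have "padic_norm ((?c - half_coeff j) * z ^ j) \<le> (?p ^ j / ?p ^ n) * (1 / ?p) ^ j"
      unfolding padic_norm_mult padic_norm_power using j m
      by (intro mult_mono power_mono hyp_coeff_congruence odd q t padic_norm_discrete z) auto
    also have "\<dots> = 1 / ?p ^ n" using p by (simp add: power_one_over)
    finally show "padic_norm (?c * z ^ j - half_coeff j * z ^ j) \<le> 1 / ?p ^ n"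
      by (simp add: left_diff_distrib)
  next
    assume j: "m < j"
    have "2 * n \<le> CARD('p) ^ n"
      using double_le_power3[of n] power_mono[of 3 "CARD('p)" n] p odd
      by (cases "CARD('p) = 2") auto
    hence "n \<le> j" using m j by simp
    hence "1 / ?p ^ j \<le> 1 / ?p ^ n" using p by (intro divide_left_mono power_increasing) auto
    thus "padic_norm (half_coeff j * z ^ j) \<le> 1 / ?p ^ n"
      using padic_norm_half_term[OF odd z, of j] by simp
  }
qed

lemma padic_norm_half_series_le_1:
  fixes z :: "'p::prime_card padic"
  assumes odd: "odd CARD('p)" and z: "padic_norm z < 1"
  shows "padic_norm (hyp2F1 (1/2) (1/2) 1 z) \<le> 1"
proof -
  have le: "padic_norm (half_coeff j * z ^ j) \<le> 1" for j
  proof -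
    have "1 / real CARD('p) ^ j \<le> 1"
      using prime_ge_1_nat[OF prime_card[where ?'a = 'p]] by simp
    thus ?thesis using padic_norm_half_term[OF assms, of j] by linarith
  qed
  have "padic_norm ((\<Sum>j\<le>0. half_coeff j * z ^ j) - hyp2F1 (1/2) (1/2) 1 z) \<le> 1"
    by (rule padic_norm_sums_diff_le[OF half_series_sums[OF assms]]) (simp_all add: le)
  from padic_norm_diff_le_bound[OF le[of 0] this] show ?thesis by simp
qed


section \<open>The eigenvector and the limit\<close>

lemma of_rat_pochhammer: "of_rat (pochhammer a k) = (pochhammer (of_rat a) k :: 'a::field_char_0)"
  by (induction k) (simp_all add: pochhammer_Suc of_rat_mult of_rat_add)

lemma of_rat_hyp_coeff:
  "of_rat (hyp_coeff a b c k) = (hyp_coeff (of_rat a) (of_rat b) (of_rat c) k :: 'a::field_char_0)"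
proof -
  have "(of_rat (fact k) :: 'a) = fact k"
    by (metis of_nat_fact of_rat_of_nat_eq)
  thus ?thesis by (simp add: hyp_coeff_def of_rat_mult of_rat_divide of_rat_pochhammer)
qed

lemma of_rat_pascal_coeff: "of_rat (pascal_coeff m k) = (pascal_coeff m k :: 'a::field_char_0)"
  by (simp add: pascal_coeff_def of_rat_hyp_coeff of_rat_minus of_rat_add of_rat_mult)

lemma of_rat_pfaff_coeff: "of_rat (pfaff_coeff m k) = (pfaff_coeff m k :: 'a::field_char_0)"
  by (simp add: pfaff_coeff_def of_rat_hyp_coeff of_rat_minus of_rat_add of_rat_mult of_rat_diff)

lemma pascal_U_generating_function:
  fixes z :: "'a::field_char_0"
  assumes "z \<noteq> 1"
  shows "pascal_U (2 * m) z = (\<Sum>k\<le>2 * m. of_rat (eigen_coeff m k) * z ^ (2 * m - k))"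
proof -
  have "pascal_U (2 * m) z
      = (\<Sum>k\<le>m. pascal_coeff m k * z ^ k) * (\<Sum>i\<le>m. pfaff_coeff m i * z ^ i)"
    by (simp add: pascal_U_eq[OF assms] pascal_hyp_eq)
  also have "\<dots> = (\<Sum>r\<le>m + m. (\<Sum>k\<le>r. pascal_coeff m k * pfaff_coeff m (r - k)) * z ^ r)"
    by (rule polynomial_product) (simp_all add: pascal_coeff_eq_0 pfaff_coeff_eq_0)
  also have "\<dots> = (\<Sum>r\<le>2 * m. of_rat (coeff (pascal_poly m * pfaff_poly m) r) * z ^ r)"
    by (simp add: coeff_mult coeff_pascal_poly coeff_pfaff_poly of_rat_sum of_rat_mult
        of_rat_pascal_coeff of_rat_pfaff_coeff mult_2)
  also have "\<dots> = (\<Sum>k\<le>2 * m. of_rat (eigen_coeff m k) * z ^ (2 * m - k))"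
    unfolding eigen_coeff_def
    by (rule sum.reindex_bij_witness[of _ "\<lambda>k. 2 * m - k" "\<lambda>k. 2 * m - k"]) auto
  finally show ?thesis .
qed

lemma eigen_coeff_last: "eigen_coeff m (2 * m) = 1"
  by (simp add: eigen_coeff_def coeff_mult coeff_pascal_poly coeff_pfaff_poly
      pascal_coeff_def pfaff_coeff_def hyp_coeff_def)

lemma eigenvector_pascal_mat_iff:
  "eigenvector (pascal_mat N) v 1 \<longleftrightarrow> dim_vec v = N + 1 \<and> v \<noteq> 0\<^sub>v (N + 1) \<and>
     (\<forall>j\<le>N. (\<Sum>k\<le>N. of_nat ((j + k) choose j) * v $ k) = v $ j)"
proof -
  have "pascal_mat N *\<^sub>v v = 1 \<cdot>\<^sub>v v \<longleftrightarrow>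
      (\<forall>j\<le>N. (\<Sum>k\<le>N. of_nat ((j + k) choose j) * v $ k) = v $ j)"
    if v: "dim_vec v = N + 1"
  proof -
    have entry: "(pascal_mat N *\<^sub>v v) $ j = (\<Sum>k\<le>N. of_nat ((j + k) choose j) * v $ k)"
      if "j \<le> N" for j
    proof -
      have "(pascal_mat N *\<^sub>v v) $ j = (\<Sum>k=0..<N + 1. of_nat ((j + k) choose j) * v $ k)"
        using that v by (auto simp: pascal_mat_def scalar_prod_def intro!: sum.cong)
      thus ?thesis by (simp only: atLeast0LessThan Suc_eq_plus1[symmetric] lessThan_Suc_atMost)
    qed
    have eq: "w = 1 \<cdot>\<^sub>v v \<longleftrightarrow> (\<forall>j\<le>N. w $ j = v $ j)" if "dim_vec w = N + 1" for w
      using that v by (auto simp: vec_eq_iff less_Suc_eq_le)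
    have "dim_vec (pascal_mat N *\<^sub>v v) = N + 1" by (simp add: pascal_mat_def)
    from eq[OF this] show ?thesis by (simp only: entry cong: imp_cong)
  qed
  moreover have "dim_row (pascal_mat N) = N + 1" by (simp add: pascal_mat_def)
  ultimately show ?thesis by (simp only: eigenvector_def carrier_vec_def mem_Collect_eq) blast
qed

lemma eigenvector_pascal_mat_unique:
  assumes "eigenvector (pascal_mat N) v 1" "eigenvector (pascal_mat N) w 1" "v $ N = w $ N"
  shows "v = w"
proof (rule eq_vecI)
  note v = assms(1)[unfolded eigenvector_pascal_mat_iff]
    and w = assms(2)[unfolded eigenvector_pascal_mat_iff]
  show "dim_vec v = dim_vec w" using v w by simp
  fix k assume "k < dim_vec w"
  hence k: "k \<le> N" using w by simp
  have "v $ k - w $ k = 0"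
    by (rule pascal_fixed_last_0[of N "\<lambda>k. v $ k - w $ k"])
       (use v w assms(3) k in \<open>auto simp: right_diff_distrib sum_subtractf\<close>)
  thus "v $ k = w $ k" by simp
qed

lemma eigenvector_eigen_coeff: "eigenvector (pascal_mat (2 * m)) (vec (2 * m + 1) (eigen_coeff m)) 1"
proof -
  have "vec (2 * m + 1) (eigen_coeff m) $ (2 * m) \<noteq> 0\<^sub>v (2 * m + 1) $ (2 * m)"
    by (simp add: eigen_coeff_last)
  hence "vec (2 * m + 1) (eigen_coeff m) \<noteq> 0\<^sub>v (2 * m + 1)" by metis
  moreover have "(\<Sum>k\<le>2 * m. of_nat ((j + k) choose j) * vec (2 * m + 1) (eigen_coeff m) $ k)
      = vec (2 * m + 1) (eigen_coeff m) $ j" if "j \<le> 2 * m" for j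
    using eigen_coeff_fixed[OF that] that by simp
  ultimately show ?thesis by (auto simp: eigenvector_pascal_mat_iff)
qed

lemma pascal_U_congruence:
  fixes z :: "'p::prime_card padic"
  assumes odd: "odd CARD('p)" and m: "2 * m + 1 = CARD('p) ^ n" and z: "padic_norm z < 1"
  shows "padic_norm (pascal_U (2 * m) z - (hyp2F1 (1/2) (1/2) 1 z)\<^sup>2) \<le> 1 / real CARD('p) ^ n"
proof -
  let ?F = "hyp2F1 (1/2) (1/2) 1 z" and ?e = "1 / real CARD('p) ^ n"
  \<comment> \<open>In terms of \<open>q = 2 m + 1\<close> the parameters are those of \<open>hyp_poly_congruence\<close>, with \<open>t = 1\<close> and \<open>t = - 3\<close>.\<close>
  define q :: "'p padic" where "q = of_nat (CARD('p) ^ n)"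
  have q': "q = 2 * of_nat m + 1" unfolding q_def m[symmetric] by simp
  define A where "A = pascal_hyp (2 * m) z"
  define B where "B = (\<Sum>i\<le>m. pfaff_coeff m i * z ^ i)"
  have F: "padic_norm ?F \<le> 1" using odd z by (rule padic_norm_half_series_le_1)
  have p: "real CARD('p) \<ge> 1" using prime_ge_1_nat[OF prime_card[where ?'a = 'p]] by simp
  have "pascal_coeff m = hyp_coeff ((1 - q) / 2) ((1 + 1 * q) / 2) (1 - q)"
    unfolding pascal_coeff_def by (rule arg_cong3[where f = hyp_coeff]) (simp_all add: q')
  hence A: "padic_norm (A - ?F) \<le> ?e"
    using hyp_poly_congruence[OF odd q_def _ m z, of 1] by (simp add: A_def pascal_hyp_eq)
  have "pfaff_coeff m = hyp_coeff ((1 - q) / 2) ((1 + (- 3) * q) / 2) (1 - q)"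
    unfolding pfaff_coeff_def by (rule arg_cong3[where f = hyp_coeff]) (simp_all add: q')
  moreover have "padic_norm (- 3 :: 'p padic) \<le> 1"
    using padic_norm_of_nat_le_1[of 3, where ?'p = 'p] by simp
  ultimately have B: "padic_norm (B - ?F) \<le> ?e"
    using hyp_poly_congruence[OF odd q_def _ m z, of "- 3"] by (simp add: B_def)
  have "?e \<le> 1" using p by simp
  with B have "padic_norm (B - ?F) \<le> 1" by (rule order.trans)
  hence B1: "padic_norm B \<le> 1"
    using padic_norm_add_le_bound[of "B - ?F" 1 ?F] F by simp
  have "z \<noteq> 1" using z by auto
  hence "pascal_U (2 * m) z = A * B" by (simp add: pascal_U_eq A_def B_def)
  hence "pascal_U (2 * m) z - ?F\<^sup>2 = (A - ?F) * B + ?F * (B - ?F)"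
    by (simp add: algebra_simps power2_eq_square)
  moreover have "padic_norm ((A - ?F) * B) \<le> ?e * 1"
    unfolding padic_norm_mult using A B1 by (intro mult_mono) auto
  moreover have "padic_norm (?F * (B - ?F)) \<le> 1 * ?e"
    unfolding padic_norm_mult using B F by (intro mult_mono) auto
  ultimately show ?thesis by (simp only: mult_1_left mult_1_right padic_norm_add_le_bound)
qed

theorem mainTheorem4:
  fixes p :: nat
  assumes p: "p = CARD('p::prime_card)" and "odd p"
  shows
    "(\<forall>n\<ge>1.
        (\<exists>!v. eigenvector (pascal_mat (p ^ n - 1)) v 1 \<and> v $ (p ^ n - 1) = 1) \<and>
        (\<forall>v. eigenvector (pascal_mat (p ^ n - 1)) v 1 \<and> v $ (p ^ n - 1) = 1 \<longrightarrow>
          (\<forall>z :: 'p padic. z \<noteq> 1 \<longrightarrow>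
            pascal_U (p ^ n - 1) z
              = (\<Sum>k\<le>p ^ n - 1. of_rat (v $ k) * z ^ (p ^ n - 1 - k))))) \<and>
     (\<forall>z :: 'p padic. padic_norm z < 1 \<longrightarrow>
        (\<lambda>k. of_nat ((2 * k) choose k) ^ 2 * z ^ k / 16 ^ k) sums hyp2F1 (1/2) (1/2) 1 z \<and>
        (\<forall>n\<ge>1. padic_cong (pascal_U (p ^ n - 1) z) ((hyp2F1 (1/2) (1/2) 1 z) ^ 2) n) \<and>
        (\<lambda>n. pascal_U (p ^ n - 1) z) \<longlonglongrightarrow> (hyp2F1 (1/2) (1/2) 1 z) ^ 2)"
proof -
  have odd: "odd CARD('p)" using assms by simp
  define m where "m n = (p ^ n - 1) div 2" for n
  have m: "2 * m n + 1 = p ^ n" for n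
    using \<open>odd p\<close> by (simp add: m_def odd_pos)
  hence N: "p ^ n - 1 = 2 * m n" for n by (metis add_diff_cancel_right')
  have p1: "real CARD('p) > 1" using prime_gt_1_nat[OF prime_card[where ?'a = 'p]] by simp
  show ?thesis
  proof (intro conjI allI impI)
    fix n
    let ?v = "vec (2 * m n + 1) (eigen_coeff (m n))"
    have v: "eigenvector (pascal_mat (p ^ n - 1)) ?v 1" "?v $ (p ^ n - 1) = 1"
      unfolding N by (simp_all add: eigenvector_eigen_coeff[simplified] eigen_coeff_last)
    have unique: "v = ?v"
      if "eigenvector (pascal_mat (p ^ n - 1)) v 1 \<and> v $ (p ^ n - 1) = 1" for v
      using that v by (intro eigenvector_pascal_mat_unique[of "p ^ n - 1"]) auto
    show "\<exists>!v. eigenvector (pascal_mat (p ^ n - 1)) v 1 \<and> v $ (p ^ n - 1) = 1"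
      using v unique by blast
    fix v and z :: "'p padic"
    assume "eigenvector (pascal_mat (p ^ n - 1)) v 1 \<and> v $ (p ^ n - 1) = 1" and z: "z \<noteq> 1"
    hence "v = ?v" using unique by blast
    thus "pascal_U (p ^ n - 1) z = (\<Sum>k\<le>p ^ n - 1. of_rat (v $ k) * z ^ (p ^ n - 1 - k))"
      unfolding N pascal_U_generating_function[OF z] by (intro sum.cong refl) auto
  next
    fix z :: "'p padic" assume z: "padic_norm z < 1"
    let ?F = "hyp2F1 (1/2) (1/2) 1 z"
    show "(\<lambda>k. of_nat ((2 * k) choose k) ^ 2 * z ^ k / 16 ^ k) sums ?F"
      using half_series_sums[OF odd z] by (simp add: half_coeff_binomial)
    have cong: "padic_norm (pascal_U (p ^ n - 1) z - ?F\<^sup>2) \<le> 1 / real CARD('p) ^ n" for n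
      unfolding N by (rule pascal_U_congruence[OF odd _ z]) (simp only: m p)
    thus "padic_cong (pascal_U (p ^ n - 1) z) (?F\<^sup>2) n" for n
      by (rule padic_congI)
    have squeeze: "D \<longlonglongrightarrow> 0"
      if "\<And>n. 0 \<le> D n" "\<And>n. D n \<le> E n" "E \<longlonglongrightarrow> 0" for D E :: "nat \<Rightarrow> real"
      by (rule tendsto_sandwich[OF _ _ tendsto_const that(3)]) (simp_all add: that)
    have "(\<lambda>n. dist (pascal_U (p ^ n - 1) z) (?F\<^sup>2)) \<longlonglongrightarrow> 0"
    proof (rule squeeze[OF zero_le_dist])
      show "dist (pascal_U (p ^ n - 1) z) (?F\<^sup>2) \<le> (1 / real CARD('p)) ^ n" for n
        unfolding dist_padic_def power_one_over by (rule cong)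
      show "(\<lambda>n. (1 / real CARD('p)) ^ n) \<longlonglongrightarrow> 0"
        using p1 by (intro LIMSEQ_power_zero) auto
    qed
    thus "(\<lambda>n. pascal_U (p ^ n - 1) z) \<longlonglongrightarrow> ?F\<^sup>2"
      by (rule iffD2[OF tendsto_dist_iff])
  qed
qed

end
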